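(* We have $\mathcal{A}\left(23,\frac12;\left(-\frac12,-\frac14\right)\cup\left(0,\frac14\right)\right)=93150$. Consequently, $C_0$ is a maximal $\left(-\frac12,-\frac14\right)\cup\left(0,\frac14\right)$-avoiding spherical $\frac12$-code.
   Context: A spherical code is a finite set $C\subset\mathbb{S}^{n-1}$; $I(C)=\{x\cdot y: x,y\in C,\ x\ne y\}$ and $s(C)=\max I(C)$; $C$ is called an $s$-code when $s(C)=s$. For $T\subset[-1,1)$, $C$ is $T$-avoiding if $I(C)\cap T=\varnothing$. $\mathcal{A}(n,s;T)$ is the maximum of $|C|$ over all $T$-avoiding spherical codes $C\subset\mathbb{S}^{n-1}$ with $s(C)\le s$; a $T$-avoiding $s$-code attaining this maximum is called maximal. The code $C_0$: let $L\subset\mathbb{S}^{23}$ be the set of the $196560$ minimal vectors of the Leech lattice rescaled to unit length. Fix $x\in L$; $C_0=\{y\in L: x\cdot y=0\}$, regarded as a subset of the unit sphere $\mathbb{S}^{22}$ of $x^\perp\cong\mathbb{R}^{23}$. It has $93150$ points and inner products $-1,\pm\frac12,\pm\frac14,0$. *)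

theory Defs
  imports "HOL-Analysis.Analysis" "HOL-Number_Theory.Cong"
begin

section \<open>Spherical codes\<close>

definition spherical_code :: "(real ^ 'n) set \<Rightarrow> bool" where
  "spherical_code C \<longleftrightarrow> finite C \<and> C \<subseteq> sphere 0 1"

definition inner_products :: "(real ^ 'n) set \<Rightarrow> real set" where
  "inner_products C = {x \<bullet> y | x y. x \<in> C \<and> y \<in> C \<and> x \<noteq> y}"

definition max_inner_product :: "(real ^ 'n) set \<Rightarrow> real" where
  "max_inner_product C = Max (inner_products C)"

definition avoiding :: "real set \<Rightarrow> (real ^ 'n) set \<Rightarrow> bool" where
  "avoiding T C \<longleftrightarrow> inner_products C \<inter> T = {}"

text \<open>
  Codes with at most one point have no inner products; the condition
  \<open>s(C) \<le> s\<close> is then taken to hold, while \<open>s(C) = s\<close> is taken to fail.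
\<close>

definition code_le :: "real \<Rightarrow> (real ^ 'n) set \<Rightarrow> bool" where
  "code_le s C \<longleftrightarrow> spherical_code C \<and>
     (inner_products C \<noteq> {} \<longrightarrow> max_inner_product C \<le> s)"

definition code_eq :: "real \<Rightarrow> (real ^ 'n) set \<Rightarrow> bool" where
  "code_eq s C \<longleftrightarrow> spherical_code C \<and>
     inner_products C \<noteq> {} \<and> max_inner_product C = s"

text \<open>
  The quantity \<open>\<A>(n, s; T)\<close>; the dimension \<open>n\<close> is the cardinality of the index
  type, so \<open>\<A>(23, s; T)\<close> is \<open>max_code_size TYPE(23) s T\<close>. For \<open>s < 1\<close> the
  cardinalities are bounded, so the maximum exists.
\<close>

definition max_code_size :: "'n::finite itself \<Rightarrow> real \<Rightarrow> real set \<Rightarrow> nat" where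
  "max_code_size _ s T =
     Max {card C | C :: (real ^ 'n) set. code_le s C \<and> avoiding T C}"

definition maximal_code :: "real \<Rightarrow> real set \<Rightarrow> (real ^ 'n) set \<Rightarrow> bool" where
  "maximal_code s T C \<longleftrightarrow>
     code_eq s C \<and> avoiding T C \<and> card C = max_code_size TYPE('n) s T"


section \<open>The Leech lattice\<close>

text \<open>
  The 24 coordinates are labelled by the projective line over the field with 23
  elements: the numeral type \<open>23\<close> is the ring of integers modulo 23, and \<open>None\<close>
  is the point at infinity. The extended binary Golay code is the quadratic residue
  code on these labels (Conway--Sloane), with a word identified with its support and
  addition of words with symmetric difference. It is spanned by the full set and the
  translates of the set consisting of 0 and the quadratic non-residues.
\<close>

type_synonym coord = "23 option"

lemma card_coord: "CARD(coord) = 24"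
  by simp

definition golay_base :: "23 set" where
  "golay_base = {n. n = 0 \<or> \<not> (\<exists>y. n = y * y)}"

definition golay_generators :: "coord set set" where
  "golay_generators = insert UNIV (range (\<lambda>i. (\<lambda>n. Some (n - i)) ` golay_base))"

inductive_set golay_code :: "coord set set" where
  empty: "{} \<in> golay_code"
| add: "A \<in> golay_code \<Longrightarrow> B \<in> golay_generators \<Longrightarrow> (A - B) \<union> (B - A) \<in> golay_code"

text \<open>
  The Conway--Sloane description, normalised by \<open>1 / sqrt 8\<close> so that the lattice is
  unimodular.
\<close>

definition leech_lattice :: "(real ^ coord) set" where
  "leech_lattice =
     {(\<chi> i. real_of_int (a i) / sqrt 8) | a :: coord \<Rightarrow> int.
        \<exists>m. (\<forall>i. [a i = m] (mod 2)) \<and>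
            [(\<Sum>i\<in>UNIV. a i) = 4 * m] (mod 8) \<and>
            (\<forall>k. {i. [a i = k] (mod 4)} \<in> golay_code)}"

definition minimal_vectors :: "(real ^ 'n) set \<Rightarrow> (real ^ 'n) set" where
  "minimal_vectors \<Lambda> = {v \<in> \<Lambda>. v \<noteq> 0 \<and> (\<forall>w\<in>\<Lambda>. w \<noteq> 0 \<longrightarrow> norm v \<le> norm w)}"

definition leech_sphere :: "(real ^ coord) set" where
  "leech_sphere = (\<lambda>v. v /\<^sub>R norm v) ` minimal_vectors leech_lattice"

definition C0 :: "real ^ coord \<Rightarrow> (real ^ coord) set" where
  "C0 x = {y \<in> leech_sphere. x \<bullet> y = 0}"

text \<open>
  Identification of a subspace \<open>V\<close> with Euclidean space. Preserving the inner product
  on the subspace \<open>V\<close> already forces \<open>f\<close> to be linear there; values of \<open>f\<close>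
  outside \<open>V\<close> are irrelevant.
\<close>

definition euclidean_iso_on :: "(real ^ 'm) set \<Rightarrow> (real ^ 'm \<Rightarrow> real ^ 'n) \<Rightarrow> bool" where
  "euclidean_iso_on V f \<longleftrightarrow>
     bij_betw f V UNIV \<and> (\<forall>u\<in>V. \<forall>v\<in>V. f u \<bullet> f v = u \<bullet> v)"

end

theory Submission
  imports Defs
begin

text \<open>
  The upper bound is Delsarte's linear programming bound in dimension 23 with the polynomial
  \<open>(t + 1) (t + 1/2) (t + 1/4) t (t - 1/4) (t - 1/2)\<close>, which is nonpositive on the allowed
  inner products and whose Gegenbauer coefficients are nonnegative. Positive definiteness of the
  Gegenbauer kernels of degree at most six follows from the addition formula by induction on the
  dimension.

  For the lower bound, the minimal vectors of the Leech lattice contain the three classical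
  families of shapes \<open>(\<plusminus>2\<^sup>8, 0\<^sup>1\<^sup>6)\<close>, \<open>(\<plusminus>4\<^sup>2, 0\<^sup>2\<^sup>2)\<close> and \<open>(\<minusplus>3, \<plusminus>1\<^sup>2\<^sup>3)\<close>. Their second and fourth
  moments against a fixed minimal vector are computed from the orthogonality properties of the
  Golay code; as only the inner products \<open>0, \<plusminus>1, \<plusminus>2, \<plusminus>4\<close> occur, the moments determine the
  number of vectors orthogonal to the given one. That the maximal inner product of the resulting
  code is \<open>1/2\<close> follows from a second linear programming bound: otherwise the code would have at
  most 750 points.
\<close>

section \<open>Gegenbauer kernels\<close>

text \<open>The zeros of the sextic are the six inner products of C_0. On [-1, 1/2] it is positive
  only inside the two avoided intervals, so simple zeros suffice, and since it vanishes at every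
  inner product of C_0 between distinct points the quotient of f(1) by the degree-zero coefficient
  can be exactly 93150. The two bounds support each other: the three shapes are shown to lie inside
  the shell, which yields at least 93150 orthogonal vectors, and the upper bound turns this into
  equality. The quartic terms in the fourth moments of the shapes cancel in the union, so the
  moments depend only on the norm of the fixed vector and one count serves all minimal vectors. The
  Golay code is given as a span. Evaluation is confined to its 24 generators and to two sets of
  twelve codewords that are systematic on complementary halves; size, weights and self-duality of
  the code follow from these.\<close>

text \<open>
  The monic Gegenbauer polynomial of degree \<open>k\<close> in dimension \<open>n\<close>, homogenised: \<open>s\<close> stands for
  \<open>x \<bullet> y\<close> and \<open>q\<close> for \<open>(norm x)\<^sup>2 * (norm y)\<^sup>2\<close>.
\<close>

definition gegen :: "nat \<Rightarrow> real \<Rightarrow> real \<Rightarrow> real \<Rightarrow> real" where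
  "gegen k n s q = (\<Sum>i\<le>k div 2. (-1) ^ i * fact k /
     (fact (k - 2 * i) * fact i * 2 ^ i * (\<Prod>l<i. n + 2 * real k - 4 - 2 * real l)) * s ^ (k - 2 * i) * q ^ i)"

lemma gegen_explicit:
  assumes "1 \<le> n"
  shows "gegen 0 n s q = 1"
    and "gegen 1 n s q = s"
    and "gegen 2 n s q = s^2 - q / n"
    and "gegen 3 n s q = s^3 - 3 * s * q / (n + 2)"
    and "gegen 4 n s q = s^4 - 6 * s^2 * q / (n + 4) + 3 * q^2 / ((n + 4) * (n + 2))"
    and "gegen 5 n s q = s^5 - 10 * s^3 * q / (n + 6) + 15 * s * q^2 / ((n + 6) * (n + 4))"
    and "gegen 6 n s q = s^6 - 15 * s^4 * q / (n + 8) + 45 * s^2 * q^2 / ((n + 8) * (n + 6))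
           - 15 * q^3 / ((n + 8) * (n + 6) * (n + 4))"
proof -
  have a: "{..Suc 0} = {0, 1}" "{..2::nat} = {0, 1, 2}" "{..3::nat} = {0, 1, 2, 3}"
    "{..<2::nat} = {0, 1}" "{..<3::nat} = {0, 1, 2}" by auto
  show "gegen 0 n s q = 1"
    and "gegen 1 n s q = s"
    and "gegen 2 n s q = s^2 - q / n"
    and "gegen 3 n s q = s^3 - 3 * s * q / (n + 2)"
    and "gegen 4 n s q = s^4 - 6 * s^2 * q / (n + 4) + 3 * q^2 / ((n + 4) * (n + 2))"
    and "gegen 5 n s q = s^5 - 10 * s^3 * q / (n + 6) + 15 * s * q^2 / ((n + 6) * (n + 4))"
    and "gegen 6 n s q = s^6 - 15 * s^4 * q / (n + 8) + 45 * s^2 * q^2 / ((n + 8) * (n + 6))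
           - 15 * q^3 / ((n + 8) * (n + 6) * (n + 4))"
    using assms by (simp_all add: gegen_def fact_numeral a divide_simps) (simp_all add: algebra_simps)
qed

text \<open>The coefficients of the addition formula below; \<open>j\<close> is the degree left to
  the remaining n - 1 coordinates.\<close>

definition gegen_weight :: "nat \<Rightarrow> nat \<Rightarrow> real \<Rightarrow> real" where
  "gegen_weight k j n = real (k choose j) *
     (\<Prod>i\<in>{1..<k - j}. (n + 2 * real j - 2 + 2 * real i) / (n + 2 * real j - 2 + real i))"

lemma gegen_weight_nonneg: "2 \<le> n \<Longrightarrow> 0 \<le> gegen_weight k j n"
  unfolding gegen_weight_def by (intro mult_nonneg_nonneg prod_nonneg) auto

text \<open>One coordinate is split off: x = (a, x') and y = (b, y') with s = x' . y', u = |x'|^2, v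
  = |y'|^2. Each summand is a function of x, times the same function of y, times a kernel in one
  dimension less. In each degree this is a rational identity, checked after clearing denominators;
  the homogeneous form covers x' or y' of any length, including zero.\<close>

lemma gegen_addition:
  assumes "2 \<le> n" and "k \<le> 6"
  shows "gegen k n (a * b + s) ((a\<^sup>2 + u) * (b\<^sup>2 + v)) =
    (\<Sum>j\<le>k. gegen_weight k j n * gegen (k - j) (n + 2 * real j) a (a\<^sup>2 + u)
       * gegen (k - j) (n + 2 * real j) b (b\<^sup>2 + v) * gegen j (n - 1) s (u * v))"
proof -
  have sets: "{..Suc 0} = {0, 1}" "{..2::nat} = {0, 1, 2}" "{..3::nat} = {0, 1, 2, 3}"
    "{..4::nat} = {0, 1, 2, 3, 4}" "{..5::nat} = {0, 1, 2, 3, 4, 5}"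
    "{..6::nat} = {0, 1, 2, 3, 4, 5, 6}"
    "{Suc 0..<2} = {1}" "{Suc 0..<3} = {1, 2}" "{Suc 0..<4} = {1, 2, 3}"
    "{Suc 0..<5} = {1, 2, 3, 4}" "{Suc 0..<6} = {1, 2, 3, 4, 5}" by auto
  have choose: "(4::nat) choose 2 = 6" "(5::nat) choose 2 = 10" "(5::nat) choose 3 = 10" "(3::nat) choose 2 = 3"
    "(4::nat) choose 3 = 4" "(6::nat) choose 2 = 15" "(6::nat) choose 3 = 20" "(6::nat) choose 4 = 15"
    "(5::nat) choose 4 = 5" "(6::nat) choose 5 = 6"
    by (simp_all add: eval_nat_numeral)
  note [simp] = sets choose gegen_weight_def gegen_explicit gegen_explicit(2)[simplified]
  consider "k = 0" | "k = 1" | "k = 2" | "k = 3" | "k = 4" | "k = 5" | "k = 6"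
    using assms(2) by linarith
  then show ?thesis
  proof cases
    case 1
    show ?thesis unfolding 1 using assms(1) by (simp add: divide_simps; algebra?)
  next
    case 2
    show ?thesis unfolding 2 using assms(1) by (simp add: divide_simps; algebra?)
  next
    case 3
    show ?thesis unfolding 3 using assms(1) by (simp add: divide_simps; algebra?)
  next
    case 4
    show ?thesis unfolding 4 using assms(1) by (simp add: divide_simps; algebra?)
  next
    case 5
    show ?thesis unfolding 5 using assms(1) by (simp add: divide_simps; algebra?)
  next
    case 6
    show ?thesis unfolding 6 using assms(1) by (simp add: divide_simps; algebra?)
  next
    case 7
    show ?thesis unfolding 7 using assms(1) by (simp add: divide_simps; algebra?)
  qed
qed

text \<open>Schoenberg's theorem in degree at most six. The arbitrary weights \<open>w\<close> carry
  the induction: in each term of the addition formula the factor depending on x alone is absorbed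
  into a new weight \<open>W j\<close>, and the kernel of the smaller dimension remains.\<close>

lemma gegen_positive_definite:
  fixes X :: "'c \<Rightarrow> 'i \<Rightarrow> real"
  assumes "finite I" "I \<noteq> {}" "k \<le> 6"
  shows "0 \<le> (\<Sum>x\<in>C. \<Sum>y\<in>C. w x * w y *
    gegen k (real (card I)) (\<Sum>i\<in>I. X x i * X y i) ((\<Sum>i\<in>I. (X x i)\<^sup>2) * (\<Sum>i\<in>I. (X y i)\<^sup>2)))"
  using assms
proof (induction I arbitrary: k w rule: finite_ne_induct)
  case (singleton e)
  define t where "t = (\<Sum>x\<in>C. w x * X x e ^ k)"
  \<comment> \<open>In dimension one s^2 = q, so the kernels of degree two and more vanish.\<close>
  have g: "\<exists>c\<ge>0. \<forall>a b. gegen k 1 (a * b) (a\<^sup>2 * b\<^sup>2) = c * (a ^ k * b ^ k)"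
  proof (intro exI conjI allI)
    show "0 \<le> (if k \<le> 1 then 1 else 0 :: real)" by simp
    show "gegen k 1 (a * b) (a\<^sup>2 * b\<^sup>2) = (if k \<le> 1 then 1 else 0) * (a ^ k * b ^ k)" for a b
    proof -
      consider "k = 0" | "k = 1" | "k = 2" | "k = 3" | "k = 4" | "k = 5" | "k = 6"
        using singleton(1) by linarith
      then show ?thesis
        by cases (simp_all add: gegen_explicit gegen_explicit(2)[simplified],
            simp_all add: power_mult_distrib eval_nat_numeral)
    qed
  qed
  then obtain c where c: "c \<ge> 0" "\<And>a b. gegen k 1 (a * b) (a\<^sup>2 * b\<^sup>2) = c * (a ^ k * b ^ k)"
    by blast
  have "(\<Sum>x\<in>C. \<Sum>y\<in>C. w x * w y * gegen k 1 (X x e * X y e) ((X x e)\<^sup>2 * (X y e)\<^sup>2)) = c * (t * t)"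
    unfolding c t_def sum_product by (simp add: sum_distrib_left mult_ac)
  then show ?case using c(1) by simp
next
  case (insert e I)
  define n where "n = real (card (insert e I))"
  have n: "2 \<le> n" "n - 1 = real (card I)"
    using insert.hyps by (auto simp: n_def card_gt_0_iff Suc_le_eq)
  define u where "u x = (\<Sum>i\<in>I. (X x i)\<^sup>2)" for x
  define s where "s x y = (\<Sum>i\<in>I. X x i * X y i)" for x y
  define W where "W j x = w x * gegen (k - j) (n + 2 * real j) (X x e) ((X x e)\<^sup>2 + u x)" for j x
  have "(\<Sum>x\<in>C. \<Sum>y\<in>C. w x * w y * gegen k n (X x e * X y e + s x y)
      (((X x e)\<^sup>2 + u x) * ((X y e)\<^sup>2 + u y)))
    = (\<Sum>x\<in>C. \<Sum>y\<in>C. \<Sum>j\<le>k. gegen_weight k j n *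
        (W j x * W j y * gegen j (real (card I)) (s x y) (u x * u y)))"
    unfolding gegen_addition[OF n(1) insert.prems] n(2) W_def
    by (simp add: sum_distrib_left mult_ac)
  also have "\<dots> = (\<Sum>j\<le>k. gegen_weight k j n * (\<Sum>x\<in>C. \<Sum>y\<in>C.
        W j x * W j y * gegen j (real (card I)) (s x y) (u x * u y)))"
    by (simp add: sum.swap[of _ "{..k}" C] sum_distrib_left)
  also have "\<dots> \<ge> 0"
  proof (rule sum_nonneg)
    fix j assume "j \<in> {..k}"
    then have "0 \<le> (\<Sum>x\<in>C. \<Sum>y\<in>C. W j x * W j y * gegen j (real (card I)) (s x y) (u x * u y))"
      unfolding s_def u_def using insert.prems by (intro insert.IH) simp
    then show "0 \<le> gegen_weight k j n * \<dots>"
      using gegen_weight_nonneg[OF n(1)] by (rule mult_nonneg_nonneg[rotated])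
  qed
  finally show ?case
    using insert.hyps unfolding n_def s_def u_def by simp
qed

section \<open>Linear programming bounds\<close>

text \<open>The sum of f(x . y) over all ordered pairs is estimated twice: positive definiteness
  leaves at least its degree-zero part \<alpha> 0 * |C|^2, while the off-diagonal terms are
  nonpositive, so it is at most |C| * f(1).\<close>

lemma linear_programming_bound:
  fixes C :: "(real ^ 'n) set"
  assumes C: "finite C" "C \<subseteq> sphere 0 1" "C \<noteq> {}"
    and f: "\<And>t. f t = (\<Sum>k\<le>6. \<alpha> k * gegen k (real CARD('n)) t 1)"
    and \<alpha>: "\<And>k. k \<le> 6 \<Longrightarrow> 0 \<le> \<alpha> k"
    and neg: "\<And>x y. x \<in> C \<Longrightarrow> y \<in> C \<Longrightarrow> x \<noteq> y \<Longrightarrow> f (x \<bullet> y) \<le> 0"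
  shows "\<alpha> 0 * real (card C) \<le> f 1"
proof -
  define S where "S k = (\<Sum>x\<in>C. \<Sum>y\<in>C. gegen k (real CARD('n)) (x \<bullet> y) 1)" for k
  have S: "0 \<le> S k" if "k \<le> 6" for k
  proof -
    have "(\<Sum>i\<in>UNIV. (x $ i)\<^sup>2) = 1" if "x \<in> C" for x
    proof -
      have "x \<bullet> x = 1" using C(2) that by (auto simp: norm_eq_1)
      then show ?thesis by (simp add: inner_vec_def power2_eq_square)
    qed
    then have "S k = (\<Sum>x\<in>C. \<Sum>y\<in>C. 1 * 1 * gegen k (real CARD('n)) (\<Sum>i\<in>UNIV. x $ i * y $ i)
        ((\<Sum>i\<in>UNIV. (x $ i)\<^sup>2) * (\<Sum>i\<in>UNIV. (y $ i)\<^sup>2)))"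
      unfolding S_def by (simp add: inner_vec_def cong: sum.cong)
    also have "0 \<le> \<dots>"
      by (rule gegen_positive_definite) (use that in auto)
    finally show ?thesis .
  qed
  have "S 0 = (real (card C))\<^sup>2"
    by (simp add: S_def gegen_def power2_eq_square)
  then have "\<alpha> 0 * (real (card C))\<^sup>2 = (\<Sum>k\<in>{0}. \<alpha> k * S k)" by simp
  also have "\<dots> \<le> (\<Sum>k\<le>6. \<alpha> k * S k)"
    by (intro sum_mono2) (auto simp: \<alpha> S)
  also have "\<dots> = (\<Sum>x\<in>C. \<Sum>y\<in>C. f (x \<bullet> y))"
    unfolding f S_def by (simp add: sum.swap[of _ "{..6}" C] sum_distrib_left)
  also have "\<dots> \<le> (\<Sum>x\<in>C. \<Sum>y\<in>C. if x = y then f 1 else 0)"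
  proof (intro sum_mono)
    fix x y assume "x \<in> C" "y \<in> C"
    then show "f (x \<bullet> y) \<le> (if x = y then f 1 else 0)"
      using C(2) neg by (auto simp: norm_eq_1)
  qed
  also have "\<dots> = real (card C) * f 1"
    using C(1) by simp
  finally have "real (card C) * (\<alpha> 0 * real (card C)) \<le> real (card C) * f 1"
    by (simp add: power2_eq_square mult_ac)
  then show ?thesis
    using C(1,3) by (simp add: card_gt_0_iff)
qed

lemma sum_upto_6: "(\<Sum>k\<le>6. g k) = g 0 + g 1 + g 2 + g 3 + g 4 + g 5 + (g 6 :: real)" for g :: "nat \<Rightarrow> real"
proof -
  have "{..6::nat} = {0, 1, 2, 3, 4, 5, 6}" by auto
  then show ?thesis by simp
qed

lemma code_card_le_93150:
  fixes C :: "(real ^ 23) set"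
  assumes C: "code_le (1/2) C" and T: "avoiding ({- (1/2)<..<- (1/4)} \<union> {0<..<1/4}) C"
  shows "card C \<le> 93150"
proof (cases "C = {}")
  case False
  define f where "f t = (t + 1) * (t + 1/2) * (t + 1/4) * t * (t - 1/4) * (t - 1/2)" for t :: real
  \<comment> \<open>The Gegenbauer coefficients of \<open>f\<close> in dimension 23. As f(1) =
    45/32, the bound is (45/32) * 66240 = 93150.\<close>
  define \<alpha> :: "nat \<Rightarrow> real" where
    "\<alpha> k = [1/66240, 1/2880, 61/16704, 15/464, 85/496, 1, 1] ! k" for k
  have fin: "finite C" "C \<subseteq> sphere 0 1"
    using C by (auto simp: code_le_def spherical_code_def)
  have "inner_products C = (\<lambda>(x, y). x \<bullet> y) ` {(x, y) \<in> C \<times> C. x \<noteq> y}"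
    by (auto simp: inner_products_def image_iff)
  then have fin_ip: "finite (inner_products C)"
    using fin(1) by (auto intro!: finite_imageI intro: finite_subset[of _ "C \<times> C"])
  have "\<alpha> 0 * real (card C) \<le> f 1"
  proof (rule linear_programming_bound[OF fin False])
    show "f t = (\<Sum>k\<le>6. \<alpha> k * gegen k (real CARD(23)) t 1)" for t
      unfolding sum_upto_6
      by (simp add: f_def \<alpha>_def gegen_explicit gegen_explicit(2)[simplified])
        (simp add: field_simps eval_nat_numeral)
    show "0 \<le> \<alpha> k" if "k \<le> 6" for k
    proof -
      have "\<alpha> k \<in> set [1/66240, 1/2880, 61/16704, 15/464, 85/496, 1, 1]"
        unfolding \<alpha>_def by (rule nth_mem) (use that in simp)
      then show ?thesis by auto
    qed
    show "f (x \<bullet> y) \<le> 0" if xy: "x \<in> C" "y \<in> C" "x \<noteq> y" for x y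
    proof -
      define t where "t = x \<bullet> y"
      have t: "t \<in> inner_products C" using xy by (auto simp: inner_products_def t_def)
      then have "t \<le> 1/2"
        using C Max_ge[OF fin_ip t] by (auto simp: code_le_def max_inner_product_def)
      moreover have "\<bar>t\<bar> \<le> 1"
      proof -
        have "norm x = 1" "norm y = 1" using fin(2) xy by auto
        then show ?thesis using Cauchy_Schwarz_ineq2[of x y] by (simp add: t_def)
      qed
      ultimately have "0 \<le> (t + 1) * (1/2 - t)"
        by (intro mult_nonneg_nonneg) auto
      moreover have "t \<notin> {- (1/2)<..<- (1/4)}" "t \<notin> {0<..<1/4}"
        using t T by (auto simp: avoiding_def)
      \<comment> \<open>Each quadratic is negative only strictly between its roots, that is, on one
        of the avoided intervals.\<close>
      then have "0 \<le> (t + 1/2) * (t + 1/4)" "0 \<le> t * (t - 1/4)"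
        by (auto simp: zero_le_mult_iff)
      ultimately have "0 \<le> (t + 1) * (1/2 - t) * ((t + 1/2) * (t + 1/4) * (t * (t - 1/4)))"
        by (metis mult_nonneg_nonneg)
      moreover have "f t = - ((t + 1) * (1/2 - t) * ((t + 1/2) * (t + 1/4) * (t * (t - 1/4))))"
        unfolding f_def by algebra
      ultimately show ?thesis by (simp add: t_def)
    qed
  qed
  then show ?thesis by (simp add: f_def \<alpha>_def)
qed simp

text \<open>The quintic \<open>f\<close> vanishes at all five permitted inner products, and f(1) /
  \<alpha> 0 = (45/16) / (3/800) = 750.\<close>

lemma code_card_le_750:
  fixes C :: "(real ^ 23) set"
  assumes C: "finite C" "C \<subseteq> sphere 0 1" and ip: "inner_products C \<subseteq> {-1, -1/2, -1/4, 0, 1/4}"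
  shows "card C \<le> 750"
proof (cases "C = {}")
  case False
  define f where "f t = (t + 1) * (t + 1/2) * (t + 1/4) * t * (t - 1/4)" for t :: real
  \<comment> \<open>The final 0 pads the expansion of the quintic to degree six.\<close>
  define \<alpha> :: "nat \<Rightarrow> real" where
    "\<alpha> k = [3/800, 313/7200, 23/96, 363/464, 3/2, 1, 0] ! k" for k
  have "\<alpha> 0 * real (card C) \<le> f 1"
  proof (rule linear_programming_bound[OF C False])
    show "f t = (\<Sum>k\<le>6. \<alpha> k * gegen k (real CARD(23)) t 1)" for t
      unfolding sum_upto_6
      by (simp add: f_def \<alpha>_def gegen_explicit gegen_explicit(2)[simplified])
        (simp add: field_simps eval_nat_numeral)
    show "0 \<le> \<alpha> k" if "k \<le> 6" for k
    proof -
      have "\<alpha> k \<in> set [3/800, 313/7200, 23/96, 363/464, 3/2, 1, 0]"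
        unfolding \<alpha>_def by (rule nth_mem) (use that in simp)
      then show ?thesis by auto
    qed
    show "f (x \<bullet> y) \<le> 0" if xy: "x \<in> C" "y \<in> C" "x \<noteq> y" for x y
    proof -
      have "x \<bullet> y \<in> inner_products C" using xy by (auto simp: inner_products_def)
      with ip have "x \<bullet> y \<in> {-1, -1/2, -1/4, 0, 1/4}" by blast
      then consider "x \<bullet> y = -1" | "x \<bullet> y = -1/2" | "x \<bullet> y = -1/4" | "x \<bullet> y = 0" | "x \<bullet> y = 1/4"
        by blast
      then show ?thesis by cases (simp_all only: f_def, simp_all)
    qed
  qed
  then show ?thesis by (simp add: f_def \<alpha>_def)
qed simp

section \<open>A generator matrix of the Golay code\<close>

text \<open>Numbers the positions so that sets of coordinates become bit lists that can be
  evaluated; 23 is the point at infinity.\<close>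

definition label :: "nat \<Rightarrow> coord" where
  "label k = (if k < 23 then Some (of_nat k) else None)"

lemma of_nat_23_eq_iff: "(of_nat a :: 23) = of_nat b \<longleftrightarrow> a mod 23 = b mod 23"
  by (simp add: of_nat_eq_iff_cong_CHAR cong_def)

lemma UNIV_23_eq: "(UNIV :: 23 set) = of_nat ` {..<23}"
proof -
  have "inj_on (of_nat :: nat \<Rightarrow> 23) {..<23}"
    by (auto simp: inj_on_def of_nat_23_eq_iff)
  then have "card (of_nat ` {..<23} :: 23 set) = CARD(23)"
    by (simp add: card_image)
  then show ?thesis
    by (metis card_subset_eq finite subset_UNIV)
qed

lemma bij_betw_label: "bij_betw label {..<24} UNIV"
proof -
  have inj: "inj_on label {..<24}"
    by (auto simp: inj_on_def label_def of_nat_23_eq_iff split: if_splits)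
  then have "card (label ` {..<24}) = CARD(coord)"
    by (simp add: card_image)
  then have "label ` {..<24} = UNIV"
    by (metis card_subset_eq finite subset_UNIV)
  with inj show ?thesis by (simp add: bij_betw_def)
qed

lemma label_eq_iff: "a < 24 \<Longrightarrow> b < 24 \<Longrightarrow> label a = label b \<longleftrightarrow> a = b"
  using bij_betw_label by (auto simp: bij_betw_def inj_on_def)

definition word :: "bool list \<Rightarrow> coord set" where
  "word bs = label ` {k. k < 24 \<and> bs ! k}"

lemma label_in_word: "k < 24 \<Longrightarrow> label k \<in> word bs \<longleftrightarrow> bs ! k"
  by (auto simp: word_def label_eq_iff)

lemma all_label: "(\<forall>i. P i) \<longleftrightarrow> (\<forall>k<24. P (label k))"
  using bij_betw_label unfolding bij_betw_def by (metis UNIV_I imageE lessThan_iff)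

lemma set_eq_label: "A = B \<longleftrightarrow> (\<forall>k<24. label k \<in> A \<longleftrightarrow> label k \<in> B)"
  using all_label[of "\<lambda>i. i \<in> A \<longleftrightarrow> i \<in> B"] by (simp add: set_eq_iff)

lemma word_xor:
  "length as = 24 \<Longrightarrow> length bs = 24 \<Longrightarrow> word (map2 (\<noteq>) as bs) = sym_diff (word as) (word bs)"
  by (auto simp: set_eq_label label_in_word)

lemma word_and:
  "length as = 24 \<Longrightarrow> length bs = 24 \<Longrightarrow> word (map2 (\<and>) as bs) = word as \<inter> word bs"
  by (auto simp: set_eq_label label_in_word)

definition weight :: "bool list \<Rightarrow> nat" where
  "weight bs = length (filter id bs)"

lemma card_word: "length bs = 24 \<Longrightarrow> card (word bs) = weight bs"
  unfolding word_def weight_def using bij_betw_label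
  by (subst card_image) (auto simp: length_filter_conv_card bij_betw_def intro: inj_on_subset)

definition base_bits :: "bool list" where
  "base_bits = map (\<lambda>k. k = 0 \<or> \<not> (\<exists>m\<in>set [0..<23]. m * m mod 23 = k)) [0..<23]"

lemma base_bits_iff: "k < 23 \<Longrightarrow> base_bits ! k \<longleftrightarrow> of_nat k \<in> golay_base"
proof -
  assume k: "k < 23"
  have "(of_nat k = (0::23)) = (k = 0)"
    using of_nat_23_eq_iff[of k 0] k by simp
  moreover have "(\<exists>y::23. of_nat k = y * y) \<longleftrightarrow> (\<exists>m<23. m * m mod 23 = k)"
  proof -
    have "(\<exists>y::23. of_nat k = y * y) \<longleftrightarrow> (\<exists>y\<in>of_nat ` {..<23}. of_nat k = (y * y :: 23))"
      unfolding UNIV_23_eq[symmetric] by simp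
    also have "\<dots> \<longleftrightarrow> (\<exists>m<23. (of_nat k :: 23) = of_nat (m * m))"
      by auto
    also have "\<dots> \<longleftrightarrow> (\<exists>m<23. m * m mod 23 = k)"
      unfolding of_nat_23_eq_iff using k by auto
    finally show ?thesis .
  qed
  ultimately show ?thesis
    using k by (auto simp: base_bits_def golay_base_def)
qed

text \<open>\<open>rotate m\<close> brings the entry at k + m (modulo 23) to position k, which is
  the translate by -m. The appended \<open>False\<close> is infinity, which no translate
  contains.\<close>

definition generator_bits :: "bool list list" where
  "generator_bits = replicate 24 True # map (\<lambda>m. rotate m base_bits @ [False]) [0..<23]"

lemma length_generator_bits: "bs \<in> set generator_bits \<Longrightarrow> length bs = 24"
  by (auto simp: generator_bits_def base_bits_def)

lemma golay_generators_eq: "golay_generators = word ` set generator_bits"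
proof -
  have one: "(\<lambda>n. Some (n - of_nat m)) ` golay_base = word (rotate m base_bits @ [False])" for m
  proof -
    have len: "length base_bits = 23" by (simp add: base_bits_def)
    have "label k \<in> (\<lambda>n. Some (n - of_nat m)) ` golay_base \<longleftrightarrow> (rotate m base_bits @ [False]) ! k"
      if k: "k < 24" for k
    proof (cases "k < 23")
      case True
      have "label k \<in> (\<lambda>n. Some (n - of_nat m)) ` golay_base \<longleftrightarrow> (of_nat (k + m) :: 23) \<in> golay_base"
        using True by (force simp: label_def image_iff algebra_simps)
      also have "(of_nat (k + m) :: 23) = of_nat ((m + k) mod 23)"
        by (simp add: of_nat_23_eq_iff add.commute del: of_nat_add)
      finally show ?thesis
        using True len by (simp add: nth_append nth_rotate base_bits_iff)
    next
      case False
      then show ?thesis using k len by (auto simp: label_def nth_append)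
    qed
    then show ?thesis by (simp add: set_eq_label label_in_word)
  qed
  have "word (replicate 24 True) = UNIV"
    by (simp add: set_eq_label label_in_word)
  moreover have "range (\<lambda>i. (\<lambda>n. Some (n - i)) ` golay_base)
      = (\<lambda>m. word (rotate m base_bits @ [False])) ` {..<23}"
    unfolding UNIV_23_eq image_image one ..
  ultimately show ?thesis
    by (simp add: golay_generators_def generator_bits_def image_image atLeast0LessThan)
qed

lemma base_bits_eq: "base_bits = [True, False, False, False, False, True, False, True, False, False, True, True, False, False, True, True, False, True, False, True, True, True, True]"
  by code_simp

text \<open>A condition on generators only: even intersections pass to the span by bilinearity, and
  with them divisibility of the weights by 4.\<close>

definition self_orthogonal :: "bool list list \<Rightarrow> bool" where
  "self_orthogonal wss \<longleftrightarrow>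
     list_all (\<lambda>as. weight as mod 4 = 0 \<and> list_all (\<lambda>bs. even (weight (map2 (\<and>) as bs))) wss) wss"

lemma self_orthogonal_generator_bits: "self_orthogonal generator_bits"
  unfolding generator_bits_def base_bits_eq by code_simp

definition combination :: "nat list \<Rightarrow> bool list" where
  "combination is = foldr (\<lambda>i. map2 (\<noteq>) (generator_bits ! i)) is (replicate 24 False)"

text \<open>
  Found by Gaussian elimination: summing the listed generators gives codewords that restrict to the
  standard basis on the positions 0 to 11 (left) and 12 to 23 (right), respectively.
\<close>

definition left_combinations :: "nat list list" where
  "left_combinations = [
     [0,2,3,5,8,10,11],
     [0,1,2,4,7,9,10],
     [2,7,10],
     [1,6,9],
     [1,6,7,8,9,11],
     [0,1,2,3,5,9],
     [0,2,4,5,6,7,8,9,11],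
     [0,1,3,4,5,6,7,8,10],
     [1,4,5,8,10],
     [0,1,2,4,6,8,10],
     [2,5,6,8,10],
     [0,1,2,3,4,7,8,9,10,11]]"

definition left_rows :: "bool list list" where
  "left_rows = map combination left_combinations"

definition right_combinations :: "nat list list" where
  "right_combinations = [
     [3,4,8],
     [2,4,7,8],
     [1,3,6,7],
     [1,2,7,9,11],
     [5,7,8,9,10,11],
     [3,6,7,9,10],
     [2,3,4,5,6,9],
     [1,2,5],
     [4,5,6,7,9,11],
     [5,6,10],
     [4,5,9],
     [0,1,4,6,8,10,11]]"

definition right_rows :: "bool list list" where
  "right_rows = map combination right_combinations"

text \<open>
  A word of weight 4 would meet one of the two halves in at most two positions, so it would be a sum
  of at most two rows.
\<close>

definition no_weight_4 :: "bool list list \<Rightarrow> bool" where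
  "no_weight_4 wss \<longleftrightarrow>
     list_all (\<lambda>as. weight as \<noteq> 4 \<and> list_all (\<lambda>bs. weight (map2 (\<noteq>) as bs) \<noteq> 4) wss) wss"

lemma left_rows_systematic: "map (take 12) left_rows = map (\<lambda>i. map ((=) i) [0..<12]) [0..<12]"
  unfolding left_rows_def left_combinations_def combination_def generator_bits_def base_bits_eq by code_simp

lemma right_rows_systematic: "map (drop 12) right_rows = map (\<lambda>i. map ((=) i) [0..<12]) [0..<12]"
  unfolding right_rows_def right_combinations_def combination_def generator_bits_def base_bits_eq by code_simp

lemma no_weight_4_rows: "no_weight_4 left_rows" "no_weight_4 right_rows"
  unfolding left_rows_def left_combinations_def right_rows_def right_combinations_def combination_def generator_bits_def base_bits_eq by code_simp+

section \<open>Self-duality and weights of the Golay code\<close>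

lemma card_sym_diff:
  fixes A B :: "'a::finite set"
  shows "card (sym_diff A B) + 2 * card (A \<inter> B) = card A + card B"
proof -
  have "card (sym_diff A B) = card (A - B) + card (B - A)"
    by (rule card_Un_disjoint) auto
  moreover have "card A = card (A - B) + card (A \<inter> B)" "card B = card (B - A) + card (A \<inter> B)"
    by (subst card_Un_disjoint[symmetric]; auto intro: arg_cong[where f = card])+
  ultimately show ?thesis by simp
qed

lemma even_card_sym_diff_inter:
  fixes A B C :: "'a::finite set"
  shows "even (card (sym_diff A B \<inter> C)) \<longleftrightarrow> even (card (A \<inter> C)) = even (card (B \<inter> C))"
proof -
  have "sym_diff A B \<inter> C = sym_diff (A \<inter> C) (B \<inter> C)" by auto
  then have "card (sym_diff A B \<inter> C) + 2 * card (A \<inter> C \<inter> (B \<inter> C)) = card (A \<inter> C) + card (B \<inter> C)"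
    using card_sym_diff[of "A \<inter> C" "B \<inter> C"] by metis
  then show ?thesis by (metis even_add even_mult_iff even_numeral)
qed

lemma generator_in_golay_code: "B \<in> golay_generators \<Longrightarrow> B \<in> golay_code"
  using golay_code.add[OF golay_code.empty, of B] by simp

lemma UNIV_in_golay_code: "UNIV \<in> golay_code"
  by (rule generator_in_golay_code) (simp add: golay_generators_def)

lemma sym_diff_in_golay_code: "B \<in> golay_code \<Longrightarrow> A \<in> golay_code \<Longrightarrow> sym_diff A B \<in> golay_code"
proof (induction B rule: golay_code.induct)
  case (add B g)
  have "sym_diff A (sym_diff B g) = sym_diff (sym_diff A B) g" by auto
  then show ?case using golay_code.add[OF add.IH[OF add.prems] add.hyps(2)] by metis
qed simp

lemma compl_in_golay_code: "A \<in> golay_code \<Longrightarrow> - A \<in> golay_code"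
  using sym_diff_in_golay_code[OF UNIV_in_golay_code, of A] by (simp add: Compl_eq_Diff_UNIV)

lemma golay_generators_orthogonal:
  assumes "A \<in> golay_generators" "B \<in> golay_generators"
  shows "4 dvd card A" "even (card (A \<inter> B))"
proof -
  obtain as bs where *: "as \<in> set generator_bits" "A = word as" "bs \<in> set generator_bits" "B = word bs"
    using assms unfolding golay_generators_eq by blast
  note len = length_generator_bits[OF *(1)] length_generator_bits[OF *(3)]
  have "weight as mod 4 = 0" "even (weight (map2 (\<and>) as bs))"
    using self_orthogonal_generator_bits * by (auto simp: self_orthogonal_def list_all_iff)
  then show "4 dvd card A" "even (card (A \<inter> B))"
    using len by (auto simp: * card_word dvd_eq_mod_eq_0 simp flip: word_and)
qed

lemma golay_code_generator_even: "A \<in> golay_code \<Longrightarrow> B \<in> golay_generators \<Longrightarrow> even (card (A \<inter> B))"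
  by (induction A rule: golay_code.induct)
     (simp_all add: even_card_sym_diff_inter golay_generators_orthogonal)

text \<open>Adding a generator preserves divisibility by 4, since |A + B| = |A| + |B| - 2 |A Int B|
  and the intersection is even.\<close>

lemma golay_code_doubly_even: "A \<in> golay_code \<Longrightarrow> 4 dvd card A"
proof (induction A rule: golay_code.induct)
  case (add A B)
  obtain k where "card (A \<inter> B) = 2 * k"
    using golay_code_generator_even[OF add.hyps] by blast
  moreover have "4 dvd card A" "4 dvd card B"
    using add.IH golay_generators_orthogonal(1)[OF add.hyps(2) add.hyps(2)] by simp_all
  ultimately show ?case
    using card_sym_diff[of A B] by presburger
qed simp

lemma golay_code_self_orthogonal: "B \<in> golay_code \<Longrightarrow> A \<in> golay_code \<Longrightarrow> even (card (A \<inter> B))"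
proof (induction B rule: golay_code.induct)
  case (add B g)
  then have "even (card (B \<inter> A))" "even (card (g \<inter> A))"
    using golay_code_generator_even[of A g] by (simp_all add: Int_commute)
  then show ?case by (simp add: Int_commute[of A] even_card_sym_diff_inter)
qed simp

lemma length_generators: "length generator_bits = 24"
  by (simp add: generator_bits_def)

lemma length_generator_nth: "i < 24 \<Longrightarrow> length (generator_bits ! i) = 24"
  by (rule length_generator_bits, rule nth_mem) (simp add: length_generators)

lemma length_combination: "set is \<subseteq> {..<24} \<Longrightarrow> length (combination is) = 24"
  by (induction "is") (auto simp: combination_def length_generator_nth)

lemma combination_in_golay_code: "set is \<subseteq> {..<24} \<Longrightarrow> word (combination is) \<in> golay_code"
proof (induction "is")
  case Nil
  have "word (replicate 24 False) = {}" by (simp add: set_eq_label label_in_word)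
  then show ?case by (simp add: combination_def golay_code.empty)
next
  case (Cons i "is")
  have "word (generator_bits ! i) \<in> golay_generators"
    using Cons.prems by (auto simp: golay_generators_eq length_generators intro!: imageI nth_mem)
  then have "sym_diff (word (generator_bits ! i)) (word (combination is)) \<in> golay_code"
    using Cons by (intro sym_diff_in_golay_code[OF _ generator_in_golay_code]) auto
  moreover have "word (combination (i # is)) = sym_diff (word (generator_bits ! i)) (word (combination is))"
    using Cons.prems length_combination[of "is"]
    by (subst word_xor[symmetric]) (auto simp: combination_def length_generator_nth)
  ultimately show ?case by metis
qed

lemma rows_in_golay_code:
  assumes "w \<in> set left_rows \<union> set right_rows"
  shows "length w = 24" "word w \<in> golay_code"
proof -
  obtain "is" where "is \<in> set left_combinations \<union> set right_combinations" "w = combination is"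
    using assms by (auto simp: left_rows_def right_rows_def)
  moreover from this have "set is \<subseteq> {..<24}"
    by (auto simp: left_combinations_def right_combinations_def)
  ultimately show "length w = 24" "word w \<in> golay_code"
    by (simp_all add: length_combination combination_in_golay_code)
qed

text \<open>The codewords \<open>g i\<close> restrict to the unit vectors on \<open>I\<close>, as
  the rows of a systematic generator matrix do. The weight clauses carry over the evaluated checks
  on single rows and on sums of two rows.\<close>

definition systematic :: "coord set \<Rightarrow> (coord \<Rightarrow> coord set) \<Rightarrow> bool" where
  "systematic I g \<longleftrightarrow> (\<forall>i\<in>I. g i \<in> golay_code \<and> g i \<inter> I = {i} \<and> card (g i) \<noteq> 4 \<and>
     (\<forall>j\<in>I. card (sym_diff (g i) (g j)) \<noteq> 4))"

lemma systematic_rows: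
  assumes wss: "set wss \<subseteq> set left_rows \<union> set right_rows" "no_weight_4 wss"
    and I: "I = label ` J" "J \<subseteq> {..<24}"
    and unit: "\<And>k. k \<in> J \<Longrightarrow> \<exists>w\<in>set wss. \<forall>l\<in>J. w ! l \<longleftrightarrow> k = l"
  shows "\<exists>g. systematic I g"
proof -
  have "\<exists>w\<in>set wss. word w \<inter> I = {i}" if "i \<in> I" for i
  proof -
    from that obtain k where k: "k \<in> J" "i = label k" using I by blast
    with unit obtain w where w: "w \<in> set wss" "\<forall>l\<in>J. w ! l \<longleftrightarrow> k = l" by blast
    have "word w \<inter> I = {i}"
      using w(2) k I by (auto simp: label_in_word subset_iff)
    with w(1) show ?thesis by blast
  qed
  then obtain f where f: "\<And>i. i \<in> I \<Longrightarrow> f i \<in> set wss \<and> word (f i) \<inter> I = {i}"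
    by metis
  have "systematic I (\<lambda>i. word (f i))"
    unfolding systematic_def
  proof (intro ballI conjI)
    fix i assume i: "i \<in> I"
    then have fi: "f i \<in> set wss" "length (f i) = 24" "word (f i) \<in> golay_code" "word (f i) \<inter> I = {i}"
      using f rows_in_golay_code wss(1) by blast+
    then show "word (f i) \<in> golay_code" "word (f i) \<inter> I = {i}" by auto
    show "card (word (f i)) \<noteq> 4"
      using fi wss(2) by (simp add: card_word no_weight_4_def list_all_iff)
    fix j assume "j \<in> I"
    then have fj: "f j \<in> set wss" "length (f j) = 24"
      using f rows_in_golay_code wss(1) by blast+
    have "card (word (map2 (\<noteq>) (f i) (f j))) \<noteq> 4"
      using fi fj wss(2) by (subst card_word) (auto simp: no_weight_4_def list_all_iff)
    then show "card (sym_diff (word (f i)) (word (f j))) \<noteq> 4"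
      using word_xor[OF fi(2) fj(2)] by simp
  qed
  then show ?thesis by blast
qed

text \<open>Two complementary sets of twelve positions, each with systematic rows. Both are wanted
  because a word of weight 4 may be light on either half.\<close>

lemma systematic_halves: "\<exists>I g h. card I = 12 \<and> systematic I g \<and> systematic (- I) h"
proof (intro exI conjI)
  let ?I = "label ` {..<12}"
  show "card ?I = 12"
    using bij_betw_label by (subst card_image) (auto simp: bij_betw_def intro: inj_on_subset)
  have compl: "- ?I = label ` {12..<24}"
    by (auto simp: set_eq_label label_eq_iff image_iff)
  have len: "length w = 24" if "w \<in> set left_rows \<union> set right_rows" for w
    using rows_in_golay_code that by blast
  have length_rows: "length left_rows = 12" "length right_rows = 12"
    by (simp_all add: left_rows_def right_rows_def left_combinations_def right_combinations_def)
  have "\<exists>g. systematic ?I g"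
  proof (rule systematic_rows)
    show "\<exists>w\<in>set left_rows. \<forall>l\<in>{..<12}. w ! l \<longleftrightarrow> k = l" if "k \<in> {..<12}" for k
    proof (intro bexI ballI)
      fix l :: nat assume l: "l \<in> {..<12}"
      have "left_rows ! k ! l = take 12 (left_rows ! k) ! l" using l by simp
      also have "take 12 (left_rows ! k) = map (take 12) left_rows ! k"
        using that by (simp add: length_rows)
      finally show "left_rows ! k ! l \<longleftrightarrow> k = l"
        using that l unfolding left_rows_systematic by simp
    next
      show "left_rows ! k \<in> set left_rows" by (rule nth_mem) (use that in \<open>simp add: length_rows\<close>)
    qed
  qed (auto simp: no_weight_4_rows)
  then show "systematic ?I (SOME g. systematic ?I g)" by (rule someI_ex)
  have "\<exists>g. systematic (- ?I) g"
  proof (rule systematic_rows[OF _ _ compl])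
    show "\<exists>w\<in>set right_rows. \<forall>l\<in>{12..<24}. w ! l \<longleftrightarrow> k = l" if k: "k \<in> {12..<24}" for k
    proof (intro bexI ballI)
      fix l :: nat assume l: "l \<in> {12..<24}"
      have mem: "right_rows ! (k - 12) \<in> set right_rows"
        by (rule nth_mem) (use k in \<open>auto simp: length_rows\<close>)
      have "right_rows ! (k - 12) ! l = drop 12 (right_rows ! (k - 12)) ! (l - 12)"
        using l len mem by simp
      also have "drop 12 (right_rows ! (k - 12)) = map (drop 12) right_rows ! (k - 12)"
        using k by (auto simp: length_rows)
      finally show "right_rows ! (k - 12) ! l \<longleftrightarrow> k = l"
        using k l unfolding right_rows_systematic by auto
    next
      show "right_rows ! (k - 12) \<in> set right_rows"
        by (rule nth_mem) (use k in \<open>auto simp: length_rows\<close>)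
    qed
  qed (auto simp: no_weight_4_rows)
  then show "systematic (- ?I) (SOME g. systematic (- ?I) g)" by (rule someI_ex)
qed

text \<open>The row \<open>h j\<close> meets the complement of \<open>I\<close> only in j, so its
  intersection with \<open>S\<close> has even size only if j is not in \<open>S\<close>.\<close>

lemma orthogonal_eq_empty:
  assumes h: "systematic (- I) h" and S: "\<And>A. A \<in> golay_code \<Longrightarrow> even (card (S \<inter> A))" "S \<inter> I = {}"
  shows "S = {}"
proof (rule ccontr)
  assume "S \<noteq> {}"
  then obtain j where j: "j \<in> S" "j \<in> - I" using S(2) by blast
  with h have "h j \<in> golay_code" "h j \<inter> - I = {j}" by (auto simp: systematic_def)
  moreover from this have "S \<inter> h j = {j}" using j S(2) by blast
  ultimately show False using S(1)[of "h j"] by simp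
qed

text \<open>Adding the row \<open>g i\<close> removes i from the part of \<open>S\<close> inside
  \<open>I\<close> and keeps \<open>S\<close> orthogonal to the code. Once \<open>S\<close> misses
  \<open>I\<close> it is empty, so the original \<open>S\<close> is a sum of rows.\<close>

lemma golay_code_self_dual:
  assumes "\<And>A. A \<in> golay_code \<Longrightarrow> even (card (S \<inter> A))"
  shows "S \<in> golay_code"
proof -
  obtain I g h where gh: "systematic I g" "systematic (- I) h"
    using systematic_halves by blast
  show ?thesis
    using assms
  proof (induction "card (S \<inter> I)" arbitrary: S)
    case 0
    then have "S \<inter> I = {}" by simp
    with 0 have "S = {}" by (metis orthogonal_eq_empty[OF gh(2)])
    then show ?case by (simp add: golay_code.empty)
  next
    case (Suc n)
    then obtain i where i: "i \<in> S" "i \<in> I"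
      by (metis Int_iff card_eq_0_iff equals0I nat.distinct(1))
    then have gi: "g i \<in> golay_code" "g i \<inter> I = {i}" using gh(1) by (auto simp: systematic_def)
    have "sym_diff S (g i) \<inter> I = S \<inter> I - {i}"
      using gi(2) i unfolding set_eq_iff Int_iff singleton_iff Diff_iff Un_iff by metis
    then have "n = card (sym_diff S (g i) \<inter> I)" using Suc.hyps(2) i by simp
    moreover have "even (card (sym_diff S (g i) \<inter> A))" if "A \<in> golay_code" for A
      using Suc.prems[OF that] golay_code_self_orthogonal[OF that gi(1)] by (simp add: even_card_sym_diff_inter)
    ultimately have "sym_diff S (g i) \<in> golay_code" by (rule Suc.hyps(1))
    then have "sym_diff (sym_diff S (g i)) (g i) \<in> golay_code"
      by (rule sym_diff_in_golay_code[OF gi(1)])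
    moreover have "sym_diff (sym_diff S (g i)) (g i) = S" by auto
    ultimately show ?case by simp
  qed
qed

lemma golay_code_eqI:
  assumes h: "systematic (- I) h" and "A \<in> golay_code" "B \<in> golay_code" "A \<inter> I = B \<inter> I"
  shows "A = B"
proof -
  have "sym_diff A B \<in> golay_code" using assms by (intro sym_diff_in_golay_code)
  moreover have "sym_diff A B \<inter> I = {}" using assms(4) by blast
  ultimately have "sym_diff A B = {}"
    using orthogonal_eq_empty[OF h] golay_code_self_orthogonal by metis
  then show ?thesis by blast
qed

text \<open>The twelve positions of \<open>I\<close> can be prescribed freely and determine the
  word, so there are 2^12 words.\<close>

lemma card_golay_code: "card golay_code = 4096"
proof -
  obtain I g h where gh: "card I = 12" "systematic I g" "systematic (- I) h"
    using systematic_halves by blast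
  have "bij_betw (\<lambda>A. A \<inter> I) golay_code (Pow I)"
    unfolding bij_betw_def
  proof
    show "inj_on (\<lambda>A. A \<inter> I) golay_code"
      by (rule inj_onI) (rule golay_code_eqI[OF gh(3)])
    have "X \<in> (\<lambda>A. A \<inter> I) ` golay_code" if "X \<subseteq> I" for X
      using finite[of X] that
    proof (induction X)
      case empty
      show ?case by (rule image_eqI[OF _ golay_code.empty]) simp
    next
      case (insert i X)
      then obtain A where A: "A \<in> golay_code" "X = A \<inter> I" by auto
      have gi: "g i \<in> golay_code" "g i \<inter> I = {i}" using gh(2) insert by (auto simp: systematic_def)
      then have "x \<in> g i \<longleftrightarrow> x = i" if "x \<in> I" for x using that by blast
      then have "insert i X = sym_diff A (g i) \<inter> I"
        using A(2) insert.hyps(2) insert.prems by auto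
      then show ?case using sym_diff_in_golay_code[OF gi(1) A(1)] by blast
    qed
    then show "(\<lambda>A. A \<inter> I) ` golay_code = Pow I" by auto
  qed
  from bij_betw_same_card[OF this] gh(1) show ?thesis by (simp add: card_Pow)
qed

text \<open>A word is determined by its trace on \<open>I\<close>, so here it is empty, a row, or a
  sum of two rows, whose weights are covered by \<open>systematic\<close>.\<close>

lemma systematic_card_neq_4:
  assumes g: "systematic I g" and h: "systematic (- I) h" and A: "A \<in> golay_code" "card (A \<inter> I) \<le> 2"
  shows "card A \<noteq> 4"
proof -
  consider "A \<inter> I = {}" | i where "A \<inter> I = {i}" | i j where "A \<inter> I = {i, j}" "i \<noteq> j"
  proof -
    have "card (A \<inter> I) = 0 \<or> card (A \<inter> I) = 1 \<or> card (A \<inter> I) = 2" using A(2) by linarith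
    then show ?thesis using that by (auto simp: card_1_singleton_iff card_2_iff)
  qed
  then show ?thesis
  proof cases
    case 1
    have "A = {}" by (rule golay_code_eqI[OF h A(1) golay_code.empty]) (simp add: 1)
    then show ?thesis by simp
  next
    case (2 i)
    then have "i \<in> I" by blast
    with g have "A = g i" by (intro golay_code_eqI[OF h A(1)]) (auto simp: systematic_def 2)
    with g \<open>i \<in> I\<close> show ?thesis by (simp add: systematic_def)
  next
    case (3 i j)
    then have ij: "i \<in> I" "j \<in> I" by blast+
    then have gij: "g i \<in> golay_code" "g j \<in> golay_code" "g i \<inter> I = {i}" "g j \<inter> I = {j}"
      using g by (auto simp: systematic_def)
    then have "x \<in> g i \<longleftrightarrow> x = i" "x \<in> g j \<longleftrightarrow> x = j" if "x \<in> I" for x using that by blast+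
    then have "A \<inter> I = sym_diff (g i) (g j) \<inter> I"
      using 3 ij by auto
    then have "A = sym_diff (g i) (g j)"
      by (rule golay_code_eqI[OF h A(1) sym_diff_in_golay_code[OF gij(2,1)]])
    with g ij show ?thesis by (simp add: systematic_def)
  qed
qed

lemma golay_code_card:
  assumes "A \<in> golay_code"
  shows "card A \<in> {0, 8, 12, 16, 24}"
proof -
  have ne4: "card B \<noteq> 4" if B: "B \<in> golay_code" for B
  proof
    assume 4: "card B = 4"
    obtain I g h where gh: "systematic I g" "systematic (- I) h"
      using systematic_halves by blast
    have "card B = card (B \<inter> I) + card (B \<inter> - I)"
      by (subst card_Un_disjoint[symmetric]) (auto intro: arg_cong[where f = card])
    then have "card (B \<inter> I) \<le> 2 \<or> card (B \<inter> - I) \<le> 2" using 4 by linarith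
    then show False
      using systematic_card_neq_4[OF gh B] systematic_card_neq_4[of "- I" h g, OF gh(2) _ B] gh(1) 4 by auto
  qed
  have "card (- A) = 24 - card A"
    by (simp add: Compl_eq_Diff_UNIV card_Diff_subset)
  moreover have "card A \<le> 24" using card_mono[OF finite subset_UNIV, of A] by simp
  \<comment> \<open>The complement is also a codeword, so excluding weight 4 excludes weight 20 as
    well.\<close>
  moreover have "card A \<noteq> 4" "card (- A) \<noteq> 4"
    using ne4 assms compl_in_golay_code by auto
  moreover obtain k where "card A = 4 * k" using golay_code_doubly_even[OF assms] by auto
  ultimately have "k \<le> 6" "k \<noteq> 1" "k \<noteq> 5" "card A = 4 * k" by auto
  moreover from this have "k = 0 \<or> k = 2 \<or> k = 3 \<or> k = 4 \<or> k = 6" by linarith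
  ultimately show ?thesis by auto
qed

section \<open>Sign moments and octad counts\<close>

definition sign_at :: "'a set \<Rightarrow> 'a \<Rightarrow> real" where
  "sign_at E i = (if i \<in> E then -1 else 1)"

text \<open>An orthogonal array of strength t: for a uniformly chosen E in \<open>F\<close>, the
  signs on \<open>S\<close> have the same mixed moments up to degree t as independent random
  signs.\<close>

definition orthogonal_signs :: "nat \<Rightarrow> 'a set set \<Rightarrow> 'a set \<Rightarrow> bool" where
  "orthogonal_signs t F S \<longleftrightarrow> finite F \<and> finite S \<and>
     (\<forall>A. A \<subseteq> S \<longrightarrow> A \<noteq> {} \<longrightarrow> card A \<le> t \<longrightarrow> (\<Sum>E\<in>F. \<Prod>i\<in>A. sign_at E i) = 0)"

lemma orthogonal_signsD:
  "orthogonal_signs t F S \<Longrightarrow> A \<subseteq> S \<Longrightarrow> A \<noteq> {} \<Longrightarrow> card A \<le> t \<Longrightarrow>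
    (\<Sum>E\<in>F. \<Prod>i\<in>A. sign_at E i) = 0"
  unfolding orthogonal_signs_def by blast

lemma sign_at_square: "sign_at E i * sign_at E i = 1"
  by (simp add: sign_at_def)

lemma prod_sign_at: "finite A \<Longrightarrow> (\<Prod>i\<in>A. sign_at E i) = (-1) ^ card (A \<inter> E)"
  by (induction A rule: finite_induct) (auto simp: sign_at_def Int_insert_left)

text \<open>Adding g permutes \<open>F\<close> and multiplies the product over \<open>A\<close> by
  (-1)^|A Int g| = -1, so the sum equals its own negative.\<close>

lemma sum_prod_sign_at_eq_0:
  assumes "finite A" and closed: "\<And>E. E \<in> F \<Longrightarrow> sym_diff E g \<in> F" and odd: "odd (card (A \<inter> g))"
  shows "(\<Sum>E\<in>F. \<Prod>i\<in>A. sign_at E i) = 0"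
proof -
  have flip: "(\<Prod>i\<in>A. sign_at (sym_diff E g) i) = - (\<Prod>i\<in>A. sign_at E i)" for E
  proof -
    have "(\<Prod>i\<in>A. sign_at (sym_diff E g) i) = (\<Prod>i\<in>A. sign_at E i * sign_at g i)"
      by (rule prod.cong) (auto simp: sign_at_def)
    also have "\<dots> = (\<Prod>i\<in>A. sign_at E i) * (-1) ^ card (A \<inter> g)"
      by (simp add: prod.distrib prod_sign_at[OF assms(1)])
    finally show ?thesis using odd by simp
  qed
  have twice: "sym_diff (sym_diff E g) g = E" for E by auto
  have "(\<Sum>E\<in>F. \<Prod>i\<in>A. sign_at E i) = (\<Sum>E\<in>F. \<Prod>i\<in>A. sign_at (sym_diff E g) i)"
    by (rule sum.reindex_bij_witness[of _ "\<lambda>E. sym_diff E g" "\<lambda>E. sym_diff E g"])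
       (simp_all only: twice closed)
  also have "\<dots> = - (\<Sum>E\<in>F. \<Prod>i\<in>A. sign_at E i)"
    by (simp add: flip sum_negf)
  finally show ?thesis by simp
qed

lemma orthogonal_signs_pair:
  assumes F: "orthogonal_signs t F S" "2 \<le> t" and ij: "i \<in> S" "j \<in> S"
  shows "(\<Sum>E\<in>F. sign_at E i * sign_at E j) = (if i = j then real (card F) else 0)"
proof (cases "i = j")
  case False
  then have "(\<Sum>E\<in>F. \<Prod>i\<in>{i, j}. sign_at E i) = 0"
    using F(2) ij by (intro orthogonal_signsD[OF F(1)]) auto
  with False show ?thesis by simp
qed (simp add: sign_at_square)

text \<open>Four signs average to 1 if their indices pair off and to 0 otherwise. When all four
  indices agree the three pairings coincide, and the last term removes the two surplus
  counts.\<close>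

lemma orthogonal_signs_quadruple:
  assumes F: "orthogonal_signs t F S" "4 \<le> t" and ijkl: "i \<in> S" "j \<in> S" "k \<in> S" "l \<in> S"
  shows "(\<Sum>E\<in>F. sign_at E i * sign_at E j * sign_at E k * sign_at E l) =
    real (card F) * ((if i = j then 1 else 0) * (if k = l then 1 else 0)
      + (if i = k then 1 else 0) * (if j = l then 1 else 0)
      + (if i = l then 1 else 0) * (if j = k then 1 else 0)
      - 2 * (if i = j then 1 else 0) * (if i = k then 1 else 0) * (if i = l then 1 else 0))"
proof -
  have pair: "(\<Sum>E\<in>F. sign_at E x * sign_at E y) = (if x = y then real (card F) else 0)"
    if "x \<in> S" "y \<in> S" for x y
    using orthogonal_signs_pair[OF F(1)] F(2) that by simp
  have sq: "sign_at E x * sign_at E y * sign_at E x = sign_at E y"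
    "sign_at E x * sign_at E y * sign_at E y = sign_at E x"
    "sign_at E x * sign_at E y * sign_at E z * sign_at E x = sign_at E y * sign_at E z"
    "sign_at E x * sign_at E y * sign_at E z * sign_at E y = sign_at E x * sign_at E z"
    "sign_at E x * sign_at E y * sign_at E z * sign_at E z = sign_at E x * sign_at E y" for E x y z
    by (simp_all add: sign_at_def)
  consider "i = j" | "i \<noteq> j" "i = k" | "i \<noteq> j" "i \<noteq> k" "i = l"
    | "i \<noteq> j" "i \<noteq> k" "i \<noteq> l" "j = k" | "i \<noteq> j" "i \<noteq> k" "i \<noteq> l" "j \<noteq> k" "j = l"
    | "i \<noteq> j" "i \<noteq> k" "i \<noteq> l" "j \<noteq> k" "j \<noteq> l" "k = l"
    | "distinct [i, j, k, l]"
    by auto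
  then show ?thesis
  proof cases
    case 7
    then have "(\<Sum>E\<in>F. \<Prod>i\<in>{i, j, k, l}. sign_at E i) = 0"
      using F(2) ijkl by (intro orthogonal_signsD[OF F(1)]) auto
    with 7 show ?thesis by (simp add: mult.assoc)
  qed (use ijkl pair in \<open>auto simp: sign_at_square sq\<close>)
qed

lemma orthogonal_signs_second_moment:
  assumes F: "orthogonal_signs t F S" "2 \<le> t"
  shows "(\<Sum>E\<in>F. (\<Sum>i\<in>S. sign_at E i * z i)\<^sup>2) = real (card F) * (\<Sum>i\<in>S. (z i)\<^sup>2)"
proof -
  have fin: "finite S" using F by (simp add: orthogonal_signs_def)
  have "(\<Sum>E\<in>F. (\<Sum>i\<in>S. sign_at E i * z i)\<^sup>2)
      = (\<Sum>E\<in>F. \<Sum>i\<in>S. \<Sum>j\<in>S. z i * z j * (sign_at E i * sign_at E j))"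
    by (simp add: power2_eq_square sum_product mult_ac)
  also have "\<dots> = (\<Sum>i\<in>S. \<Sum>j\<in>S. z i * z j * (\<Sum>E\<in>F. sign_at E i * sign_at E j))"
    by (simp add: sum.swap[of _ S F] sum_distrib_left)
  also have "\<dots> = (\<Sum>i\<in>S. \<Sum>j\<in>S. if i = j then real (card F) * (z i)\<^sup>2 else 0)"
    by (intro sum.cong refl) (simp add: orthogonal_signs_pair[OF F] power2_eq_square)
  finally show ?thesis using fin by (simp add: sum_distrib_left)
qed

lemma orthogonal_signs_fourth_moment:
  assumes F: "orthogonal_signs t F S" "4 \<le> t"
  shows "(\<Sum>E\<in>F. (\<Sum>i\<in>S. sign_at E i * z i) ^ 4) =
    real (card F) * (3 * (\<Sum>i\<in>S. (z i)\<^sup>2)\<^sup>2 - 2 * (\<Sum>i\<in>S. z i ^ 4))"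
proof -
  have fin: "finite S" using F by (simp add: orthogonal_signs_def)
  let ?d = "\<lambda>i j. if i = j then 1 else 0 :: real"
  have pull: "(\<Sum>i\<in>S. if P then f i else 0) = (if P then sum f S else (0::real))" for P f
    by simp
  have pow4: "(x::real) ^ 4 = x * x * (x * x)" for x by (simp add: eval_nat_numeral)
  have "(\<Sum>E\<in>F. (\<Sum>i\<in>S. sign_at E i * z i) ^ 4) = (\<Sum>E\<in>F. \<Sum>i\<in>S. \<Sum>j\<in>S. \<Sum>k\<in>S. \<Sum>l\<in>S.
      z i * z j * z k * z l * (sign_at E i * sign_at E j * sign_at E k * sign_at E l))"
    unfolding pow4 sum_product by (simp add: sum_distrib_left sum_distrib_right mult_ac sum_product)
  also have "\<dots> = (\<Sum>i\<in>S. \<Sum>j\<in>S. \<Sum>k\<in>S. \<Sum>l\<in>S. z i * z j * z k * z l *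
      (\<Sum>E\<in>F. sign_at E i * sign_at E j * sign_at E k * sign_at E l))"
    by (simp add: sum.swap[of _ S F] sum_distrib_left)
  also have "\<dots> = (\<Sum>i\<in>S. \<Sum>j\<in>S. \<Sum>k\<in>S. \<Sum>l\<in>S. z i * z j * z k * z l *
      (real (card F) * (?d i j * ?d k l + ?d i k * ?d j l + ?d i l * ?d j k - 2 * ?d i j * ?d i k * ?d i l)))"
    by (intro sum.cong refl) (simp only: orthogonal_signs_quadruple[OF F])
  also have "\<dots> = real (card F) * ((\<Sum>i\<in>S. \<Sum>k\<in>S. (z i)\<^sup>2 * (z k)\<^sup>2) + (\<Sum>i\<in>S. \<Sum>j\<in>S. (z i)\<^sup>2 * (z j)\<^sup>2)
      + (\<Sum>i\<in>S. \<Sum>j\<in>S. (z i)\<^sup>2 * (z j)\<^sup>2) - 2 * (\<Sum>i\<in>S. z i ^ 4))"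
    using fin
    by (simp add: distrib_left right_diff_distrib sum.distrib sum_subtractf if_distrib[of "\<lambda>x. _ * x"]
        if_distrib[of "\<lambda>x. x * _"] sum_distrib_left power2_eq_square pow4 mult_ac pull cong: if_cong)
  finally show ?thesis
    by (simp add: power2_eq_square sum_product)
qed

text \<open>The strength is one less than the minimum weight 8: a nonempty set of at most seven
  coordinates is not a codeword, so by self-duality some codeword meets it in an odd number of
  points.\<close>

lemma golay_orthogonal_signs: "orthogonal_signs 7 golay_code UNIV"
  unfolding orthogonal_signs_def
proof (intro conjI allI impI)
  fix A :: "coord set" assume A: "A \<noteq> {}" "card A \<le> 7"
  have "A \<notin> golay_code"
    using golay_code_card[of A] A by (auto simp: card_gt_0_iff)
  then obtain g where "g \<in> golay_code" "odd (card (A \<inter> g))"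
    using golay_code_self_dual by blast
  then show "(\<Sum>E\<in>golay_code. \<Prod>i\<in>A. sign_at E i) = 0"
    by (intro sum_prod_sign_at_eq_0[of _ _ g]) (auto intro: sym_diff_in_golay_code)
qed auto

lemma even_subsets_orthogonal_signs:
  fixes S :: "'a::finite set"
  assumes "t < card S"
  shows "orthogonal_signs t {E. E \<subseteq> S \<and> even (card E)} S"
  unfolding orthogonal_signs_def
proof (intro conjI allI impI)
  fix A assume A: "A \<subseteq> S" "A \<noteq> {}" "card A \<le> t"
  have "\<not> S \<subseteq> A" using A(3) assms card_mono[of A S] by auto
  \<comment> \<open>Toggling a and b together keeps the parity of E but meets \<open>A\<close> in a
    alone; such b exists because \<open>A\<close> is smaller than \<open>S\<close>.\<close>
  with A(2) obtain a b where ab: "a \<in> A" "b \<in> S" "b \<notin> A" by blast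
  have "sym_diff E {a, b} \<subseteq> S \<and> even (card (sym_diff E {a, b}))" if "E \<subseteq> S \<and> even (card E)" for E
  proof -
    have "even (card (sym_diff E {a, b}))"
      using even_card_sym_diff_inter[of E "{a, b}" UNIV] ab that by (auto simp: card_insert_if)
    then show ?thesis using that ab A by auto
  qed
  moreover have "A \<inter> {a, b} = {a}" using ab by auto
  ultimately show "(\<Sum>E\<in>{E. E \<subseteq> S \<and> even (card E)}. \<Prod>i\<in>A. sign_at E i) = 0"
    by (intro sum_prod_sign_at_eq_0[of _ _ "{a, b}"]) auto
qed (use assms in auto)

lemma subsets_orthogonal_signs:
  assumes "finite S"
  shows "orthogonal_signs t (Pow S) S"
  unfolding orthogonal_signs_def
proof (intro conjI allI impI)
  fix A assume A: "A \<subseteq> S" "A \<noteq> {}"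
  then obtain a where a: "a \<in> A" by blast
  then have "A \<inter> {a} = {a}" by auto
  then show "(\<Sum>E\<in>Pow S. \<Prod>i\<in>A. sign_at E i) = 0"
    using A a assms finite_subset by (intro sum_prod_sign_at_eq_0[of _ _ "{a}"]) auto
qed (use assms in auto)

section \<open>Power moments of the Golay code and the octad counts\<close>

definition sign_sum :: "coord set \<Rightarrow> real" where
  "sign_sum c = (\<Sum>i\<in>UNIV. sign_at c i)"

lemma sign_sum_eq: "sign_sum c = 24 - 2 * real (card c)"
proof -
  have "sign_sum c = (\<Sum>i\<in>UNIV. 1 - 2 * (if i \<in> c then 1 else 0))"
    unfolding sign_sum_def by (rule sum.cong) (auto simp: sign_at_def)
  also have "\<dots> = 24 - 2 * real (card c)"
    by (simp add: sum_subtractf sum.If_cases flip: sum_distrib_left)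
  finally show ?thesis .
qed

text \<open>The number of sequences of k coordinates which, toggled one after another, turn a given
  set of size a into the empty set: a toggle deletes one of a elements or adds one of the 24 - a
  others. At a = 0 the truncated a - 1 comes with the factor 0.\<close>

fun sign_moment :: "nat \<Rightarrow> nat \<Rightarrow> real" where
  "sign_moment 0 a = (if a = 0 then 1 else 0)"
| "sign_moment (Suc k) a = real a * sign_moment k (a - 1) + (24 - real a) * sign_moment k (Suc a)"

text \<open>Expanding one factor \<open>sign_sum c\<close> toggles one element of \<open>A\<close>,
  because squares of signs are 1. The sets reached have at most k + |A| elements, which stays within
  strength 7.\<close>

lemma sign_moment_eq:
  "k + card A \<le> 7 \<Longrightarrow> (\<Sum>c\<in>golay_code. sign_sum c ^ k * (\<Prod>i\<in>A. sign_at c i)) = 4096 * sign_moment k (card A)"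
proof (induction k arbitrary: A)
  case 0
  then show ?case
    using orthogonal_signsD[OF golay_orthogonal_signs, of A] by (auto simp: card_golay_code)
next
  case (Suc k)
  let ?P = "\<lambda>c A. \<Prod>i\<in>A. sign_at c i"
  have step: "sign_at c j * ?P c A = ?P c (if j \<in> A then A - {j} else insert j A)" for c j
    by (auto simp: prod.remove[of A j] simp flip: mult.assoc) (simp add: sign_at_square)
  have "(\<Sum>c\<in>golay_code. sign_sum c ^ Suc k * ?P c A)
      = (\<Sum>c\<in>golay_code. \<Sum>j\<in>UNIV. sign_sum c ^ k * (sign_at c j * ?P c A))"
    by (simp add: sign_sum_def[of _] sum_distrib_left sum_distrib_right mult_ac)
  also have "\<dots> = (\<Sum>j\<in>UNIV. \<Sum>c\<in>golay_code. sign_sum c ^ k * ?P c (if j \<in> A then A - {j} else insert j A))"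
    unfolding step by (rule sum.swap)
  also have "\<dots> = (\<Sum>j\<in>UNIV. if j \<in> A then 4096 * sign_moment k (card A - 1) else 4096 * sign_moment k (Suc (card A)))"
  proof (rule sum.cong)
    fix j
    show "(\<Sum>c\<in>golay_code. sign_sum c ^ k * ?P c (if j \<in> A then A - {j} else insert j A))
      = (if j \<in> A then 4096 * sign_moment k (card A - 1) else 4096 * sign_moment k (Suc (card A)))"
      using Suc.IH[of "A - {j}"] Suc.IH[of "insert j A"] Suc.prems
      by (cases "j \<in> A") (simp_all add: card_insert_if del: prod.insert)
  qed simp
  also have "\<dots> = real (card A) * (4096 * sign_moment k (card A - 1)) + real (card (- A)) * (4096 * sign_moment k (Suc (card A)))"
    by (simp add: sum.If_cases)
  also have "real (card (- A)) = 24 - real (card A)"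
    using Suc.prems by (simp add: Compl_eq_Diff_UNIV card_Diff_subset of_nat_diff)
  finally show ?case by (simp add: algebra_simps)
qed

definition octads :: "coord set set" where
  "octads = {A \<in> golay_code. card A = 8}"

text \<open>The cubic takes the values 1, 0, 0, 0 and 9 at the weights 8, 12, 16, 24 and 0.\<close>

lemma octad_indicator:
  assumes "c \<in> golay_code"
  shows "(if card c = 8 then 1 else 0) =
    (sign_sum c ^ 3 + 32 * sign_sum c ^ 2 + 192 * sign_sum c) / 4096 - (if c = {} then 9 else 0)"
proof -
  have "card c = 0 \<longleftrightarrow> c = {}" by simp
  then show ?thesis
    using golay_code_card[OF assms] by (auto simp: sign_sum_eq)
qed

text \<open>Turns a sum over octads into power moments over the whole code; the subtracted term
  corrects for the empty word.\<close>

lemma sum_octads: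
  "(\<Sum>c\<in>octads. h c) = (\<Sum>c\<in>golay_code.
     (sign_sum c ^ 3 * h c + 32 * (sign_sum c ^ 2 * h c) + 192 * (sign_sum c ^ 1 * h c)) / 4096) - 9 * (h {} :: real)"
proof -
  have "(\<Sum>c\<in>octads. h c) = (\<Sum>c\<in>golay_code. (if card c = 8 then 1 else 0) * h c)"
    unfolding octads_def by (simp add: sum.inter_filter if_distrib[of "\<lambda>x. x * _"] cong: if_cong)
  also have "\<dots> = (\<Sum>c\<in>golay_code. (sign_sum c ^ 3 * h c + 32 * (sign_sum c ^ 2 * h c) + 192 * (sign_sum c ^ 1 * h c)) / 4096
      - (if c = {} then 9 * h {} else 0))"
    by (rule sum.cong) (auto simp: octad_indicator algebra_simps add_divide_distrib)
  finally show ?thesis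
    by (simp add: sum_subtractf golay_code.empty)
qed

text \<open>The cubic uses three of the seven available degrees, which leaves four for
  \<open>A\<close>.\<close>

lemma sum_octads_prod:
  assumes "card A \<le> 4"
  shows "(\<Sum>c\<in>octads. \<Prod>i\<in>A. sign_at c i) =
    sign_moment 3 (card A) + 32 * sign_moment 2 (card A) + 192 * sign_moment 1 (card A) - 9"
proof -
  have "(\<Prod>i\<in>A. sign_at {} i) = 1" by (simp add: sign_at_def)
  then show ?thesis
    using sign_moment_eq[of 3 A] sign_moment_eq[of 2 A] sign_moment_eq[of 1 A] assms
    by (simp add: sum_octads sum.distrib flip: sum_divide_distrib sum_distrib_left)
qed

lemma card_octads: "card octads = 759"
  using sum_octads_prod[of "{}"] by (simp add: eval_nat_numeral)

text \<open>253, like 77 for pairs below, is a parameter of the Steiner system S(5,8,24); it comes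
  out of the sign moments through the indicator (1 - sign)/2.\<close>

lemma card_octads_point: "card {c \<in> octads. i \<in> c} = 253"
proof -
  have "real (card {c \<in> octads. i \<in> c}) = (\<Sum>c\<in>octads. if i \<in> c then 1 else 0)"
    by (simp add: sum.inter_filter[symmetric])
  also have "\<dots> = (\<Sum>c\<in>octads. (1 - sign_at c i) / 2)"
    by (rule sum.cong) (auto simp: sign_at_def)
  also have "\<dots> = 253"
    using sum_octads_prod[of "{i}"] card_octads
    by (simp add: sum_subtractf eval_nat_numeral flip: sum_divide_distrib)
  finally show ?thesis by simp
qed

lemma card_octads_pair:
  assumes "i \<noteq> j"
  shows "card {c \<in> octads. i \<in> c \<and> j \<in> c} = 77"
proof -
  have "real (card {c \<in> octads. i \<in> c \<and> j \<in> c}) = (\<Sum>c\<in>octads. if i \<in> c \<and> j \<in> c then 1 else 0)"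
    by (simp add: sum.inter_filter[symmetric])
  also have "\<dots> = (\<Sum>c\<in>octads. (1 - sign_at c i - sign_at c j + sign_at c i * sign_at c j) / 4)"
    by (rule sum.cong) (auto simp: sign_at_def)
  also have "\<dots> = 77"
    using sum_octads_prod[of "{i}"] sum_octads_prod[of "{j}"] sum_octads_prod[of "{i, j}"] card_octads assms
    by (simp add: sum_subtractf sum.distrib eval_nat_numeral flip: sum_divide_distrib)
  finally show ?thesis by simp
qed

section \<open>Moments of the three shapes\<close>

text \<open>A 2-design given by its replication number r and its pair index l, the two counts that
  enter the moments below.\<close>

definition design :: "coord set set \<Rightarrow> nat \<Rightarrow> nat \<Rightarrow> bool" where
  "design \<B> r l \<longleftrightarrow> (\<forall>i. card {B\<in>\<B>. i \<in> B} = r) \<and>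
     (\<forall>i j. i \<noteq> j \<longrightarrow> card {B\<in>\<B>. i \<in> B \<and> j \<in> B} = l)"

lemma design_sum:
  assumes "design \<B> r l"
  shows "(\<Sum>B\<in>\<B>. \<Sum>i\<in>B. f i) = real r * (\<Sum>i\<in>UNIV. f i)"
proof -
  have "(\<Sum>B\<in>\<B>. \<Sum>i\<in>B. f i) = (\<Sum>B\<in>\<B>. \<Sum>i\<in>UNIV. if i \<in> B then f i else 0)"
    by (simp add: sum.If_cases)
  also have "\<dots> = (\<Sum>i\<in>UNIV. \<Sum>B\<in>\<B>. if i \<in> B then f i else 0)"
    by (rule sum.swap)
  also have "\<dots> = (\<Sum>i\<in>UNIV. real r * f i)"
    using assms by (simp add: design_def flip: sum.inter_filter)
  finally show ?thesis by (simp add: sum_distrib_left)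
qed

lemma design_sum_square:
  assumes "design \<B> r l"
  shows "(\<Sum>B\<in>\<B>. (\<Sum>i\<in>B. f i)\<^sup>2) =
    real l * (\<Sum>i\<in>UNIV. f i)\<^sup>2 + (real r - real l) * (\<Sum>i\<in>UNIV. (f i)\<^sup>2)"
proof -
  have ij: "real (card {B\<in>\<B>. i \<in> B \<and> j \<in> B}) = real l + (if i = j then real r - real l else 0)" for i j
    using assms by (auto simp: design_def)
  have "(\<Sum>B\<in>\<B>. (\<Sum>i\<in>B. f i)\<^sup>2) = (\<Sum>B\<in>\<B>. (\<Sum>i\<in>UNIV. if i \<in> B then f i else 0)\<^sup>2)"
    by (simp add: sum.If_cases)
  also have "\<dots> = (\<Sum>B\<in>\<B>. \<Sum>i\<in>UNIV. \<Sum>j\<in>UNIV. if i \<in> B \<and> j \<in> B then f i * f j else 0)"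
    unfolding power2_eq_square sum_product by (intro sum.cong refl) auto
  also have "\<dots> = (\<Sum>i\<in>UNIV. \<Sum>j\<in>UNIV. \<Sum>B\<in>\<B>. if i \<in> B \<and> j \<in> B then f i * f j else 0)"
    by (subst sum.swap, intro sum.cong refl sum.swap)
  also have "\<dots> = (\<Sum>i\<in>UNIV. \<Sum>j\<in>UNIV. f i * f j * (real l + (if i = j then real r - real l else 0)))"
    by (simp add: mult.commute flip: sum.inter_filter ij)
  also have "\<dots> = real l * (\<Sum>i\<in>UNIV. f i)\<^sup>2 + (real r - real l) * (\<Sum>i\<in>UNIV. (f i)\<^sup>2)"
    by (simp add: distrib_left sum.distrib power2_eq_square sum_product sum_distrib_left
        if_distrib[of "\<lambda>x. _ * x"] mult_ac cong: if_cong)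
  finally show ?thesis .
qed

definition signed :: "int \<Rightarrow> coord set \<Rightarrow> coord set \<Rightarrow> coord \<Rightarrow> int" where
  "signed t S E i = (if i \<in> S then if i \<in> E then - t else t else 0)"

lemma of_int_signed: "real_of_int (signed t S E i) = (if i \<in> S then real_of_int t * sign_at E i else 0)"
  by (simp add: signed_def sign_at_def)

definition signed_design :: "int \<Rightarrow> coord set set \<Rightarrow> (coord set \<Rightarrow> coord set set) \<Rightarrow> (coord \<Rightarrow> int) set" where
  "signed_design t \<B> F = (\<lambda>(B, E). signed t B E) ` Sigma \<B> F"

lemma sum_signed_design:
  assumes "0 < t" "\<And>B E. B \<in> \<B> \<Longrightarrow> E \<in> F B \<Longrightarrow> E \<subseteq> B"
  shows "(\<Sum>b\<in>signed_design t \<B> F. h b) = (\<Sum>B\<in>\<B>. \<Sum>E\<in>F B. h (signed t B E))"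
proof -
  have "inj_on (\<lambda>(B, E). signed t B E) (Sigma \<B> F)"
  proof (rule inj_onI, clarify)
    fix B E B' E' assume *: "B \<in> \<B>" "E \<in> F B" "B' \<in> \<B>" "E' \<in> F B'" "signed t B E = signed t B' E'"
    have S: "{i. signed t B E i \<noteq> 0} = B" "{i. signed t B E i < 0} = E"
      if "B \<in> \<B>" "E \<in> F B" for B E
      using assms that by (auto simp: signed_def split: if_splits)
    show "B = B' \<and> E = E'" using S[OF *(1,2)] S[OF *(3,4)] *(5) by simp
  qed
  then show ?thesis
    unfolding signed_design_def by (simp add: sum.reindex sum.Sigma case_prod_unfold)
qed

text \<open>Inside a block the signs contribute 3 (sum of a^2)^2 - 2 (sum of a^4); summing over the
  blocks with the design counts turns the quartic coefficient into 3 (r - l) - 2 r = r - 3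
  l.\<close>

lemma signed_design_moments:
  assumes t: "0 < t" and d: "design \<B> r l"
    and F: "\<And>B. B \<in> \<B> \<Longrightarrow> orthogonal_signs 4 (F B) B" "\<And>B. B \<in> \<B> \<Longrightarrow> card (F B) = m"
      "\<And>B E. B \<in> \<B> \<Longrightarrow> E \<in> F B \<Longrightarrow> E \<subseteq> B"
  shows "real (card (signed_design t \<B> F)) = real (card \<B>) * real m"
    and "(\<Sum>b\<in>signed_design t \<B> F. (\<Sum>i\<in>UNIV. a i * real_of_int (b i))\<^sup>2) =
      (real_of_int t)\<^sup>2 * real m * real r * (\<Sum>i\<in>UNIV. (a i)\<^sup>2)"
    and "(\<Sum>b\<in>signed_design t \<B> F. (\<Sum>i\<in>UNIV. a i * real_of_int (b i)) ^ 4) =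
      real_of_int t ^ 4 * real m * (3 * real l * (\<Sum>i\<in>UNIV. (a i)\<^sup>2)\<^sup>2
        + (real r - 3 * real l) * (\<Sum>i\<in>UNIV. a i ^ 4))"
proof -
  have reindex: "(\<Sum>b\<in>signed_design t \<B> F. h b) = (\<Sum>B\<in>\<B>. \<Sum>E\<in>F B. h (signed t B E))"
    for h :: "_ \<Rightarrow> real"
    by (rule sum_signed_design[OF t]) (rule F(3))
  have "real (card (signed_design t \<B> F)) = (\<Sum>B\<in>\<B>. \<Sum>E\<in>F B. 1)"
    unfolding reindex[of "\<lambda>_. 1", symmetric] by simp
  also have "\<dots> = (\<Sum>B\<in>\<B>. real m)"
    by (intro sum.cong refl) (simp add: F(2))
  finally show "real (card (signed_design t \<B> F)) = real (card \<B>) * real m" by simp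
  have inner: "(\<Sum>i\<in>UNIV. a i * real_of_int (signed t B E i)) = real_of_int t * (\<Sum>i\<in>B. sign_at E i * a i)" for B E
    by (simp add: of_int_signed if_distrib[of "\<lambda>x. _ * x"] sum.If_cases sum_distrib_left mult_ac cong: if_cong)
  have "(\<Sum>b\<in>signed_design t \<B> F. (\<Sum>i\<in>UNIV. a i * real_of_int (b i))\<^sup>2)
      = (\<Sum>B\<in>\<B>. (real_of_int t)\<^sup>2 * (\<Sum>E\<in>F B. (\<Sum>i\<in>B. sign_at E i * a i)\<^sup>2))"
    unfolding reindex inner by (simp add: power_mult_distrib flip: sum_distrib_left)
  also have "\<dots> = (real_of_int t)\<^sup>2 * real m * (\<Sum>B\<in>\<B>. \<Sum>i\<in>B. (a i)\<^sup>2)"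
    by (simp add: orthogonal_signs_second_moment[OF F(1)] F(2) mult.assoc cong: sum.cong flip: sum_distrib_left)
  finally show "(\<Sum>b\<in>signed_design t \<B> F. (\<Sum>i\<in>UNIV. a i * real_of_int (b i))\<^sup>2) =
      (real_of_int t)\<^sup>2 * real m * real r * (\<Sum>i\<in>UNIV. (a i)\<^sup>2)"
    by (simp add: design_sum[OF d])
  have "(\<Sum>b\<in>signed_design t \<B> F. (\<Sum>i\<in>UNIV. a i * real_of_int (b i)) ^ 4)
      = (\<Sum>B\<in>\<B>. real_of_int t ^ 4 * (\<Sum>E\<in>F B. (\<Sum>i\<in>B. sign_at E i * a i) ^ 4))"
    unfolding reindex inner by (simp add: power_mult_distrib flip: sum_distrib_left)
  also have "\<dots> = (\<Sum>B\<in>\<B>. real_of_int t ^ 4 * (real m * (3 * (\<Sum>i\<in>B. (a i)\<^sup>2)\<^sup>2 - 2 * (\<Sum>i\<in>B. a i ^ 4))))"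
    by (intro sum.cong refl) (simp add: orthogonal_signs_fourth_moment[OF F(1)] F(2))
  also have "\<dots> = real_of_int t ^ 4 * real m *
      (3 * (\<Sum>B\<in>\<B>. (\<Sum>i\<in>B. (a i)\<^sup>2)\<^sup>2) - 2 * (\<Sum>B\<in>\<B>. \<Sum>i\<in>B. a i ^ 4))"
    by (simp add: sum_subtractf mult.assoc flip: sum_distrib_left)
  also have "\<dots> = real_of_int t ^ 4 * real m * (3 * real l * (\<Sum>i\<in>UNIV. (a i)\<^sup>2)\<^sup>2
        + (real r - 3 * real l) * (\<Sum>i\<in>UNIV. a i ^ 4))"
    by (simp add: design_sum[OF d] design_sum_square[OF d] algebra_simps flip: power_mult)
  finally show "(\<Sum>b\<in>signed_design t \<B> F. (\<Sum>i\<in>UNIV. a i * real_of_int (b i)) ^ 4) =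
      real_of_int t ^ 4 * real m * (3 * real l * (\<Sum>i\<in>UNIV. (a i)\<^sup>2)\<^sup>2
        + (real r - 3 * real l) * (\<Sum>i\<in>UNIV. a i ^ 4))" .
qed

definition octad_vectors :: "(coord \<Rightarrow> int) set" where
  "octad_vectors = signed_design 2 octads (\<lambda>B. {E. E \<subseteq> B \<and> even (card E)})"

text \<open>The parameters are t = 2, m = 2^7, r = 253, l = 77, so r - 3 l = 22.\<close>

lemma octad_vectors_moments:
  shows "real (card octad_vectors) = 97152"
    and "(\<Sum>b\<in>octad_vectors. (\<Sum>i\<in>UNIV. a i * real_of_int (b i))\<^sup>2) = 129536 * (\<Sum>i\<in>UNIV. (a i)\<^sup>2)"
    and "(\<Sum>b\<in>octad_vectors. (\<Sum>i\<in>UNIV. a i * real_of_int (b i)) ^ 4) =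
      473088 * (\<Sum>i\<in>UNIV. (a i)\<^sup>2)\<^sup>2 + 45056 * (\<Sum>i\<in>UNIV. a i ^ 4)"
proof -
  have d: "design octads 253 77"
    by (simp add: design_def card_octads_point card_octads_pair)
  have o: "orthogonal_signs 4 {E. E \<subseteq> B \<and> even (card E)} B" if "B \<in> octads" for B
    using that by (intro even_subsets_orthogonal_signs) (simp add: octads_def)
  have c: "card {E. E \<subseteq> B \<and> even (card E)} = 128" if "B \<in> octads" for B
  proof -
    have B: "finite B" "card B = 8" using that by (auto simp: octads_def)
    then have "{} \<subset> B" by auto
    then have "card {E. E \<subseteq> B \<and> even (card E)} = card {E. E \<subseteq> B \<and> odd (card E)}"
      using card_subsupersets_even_odd[OF B(1), of "{}"] by simp
    moreover have "card {E. E \<subseteq> B \<and> even (card E)} + card {E. E \<subseteq> B \<and> odd (card E)} = card (Pow B)"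
      by (subst card_Un_disjoint[symmetric]) (auto intro!: arg_cong[where f = card])
    ultimately show ?thesis using B by (simp add: card_Pow)
  qed
  note moments = signed_design_moments[where t = 2, OF _ d o c, folded octad_vectors_def]
  show "real (card octad_vectors) = 97152"
    "(\<Sum>b\<in>octad_vectors. (\<Sum>i\<in>UNIV. a i * real_of_int (b i))\<^sup>2) = 129536 * (\<Sum>i\<in>UNIV. (a i)\<^sup>2)"
    "(\<Sum>b\<in>octad_vectors. (\<Sum>i\<in>UNIV. a i * real_of_int (b i)) ^ 4) =
      473088 * (\<Sum>i\<in>UNIV. (a i)\<^sup>2)\<^sup>2 + 45056 * (\<Sum>i\<in>UNIV. a i ^ 4)"
    by (subst moments; simp add: card_octads)+
qed

definition pair_vectors :: "(coord \<Rightarrow> int) set" where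
  "pair_vectors = signed_design 4 {P. card P = 2} Pow"

text \<open>The parameters are t = 4, m = 4, r = 23, l = 1, so r - 3 l = 20.\<close>

lemma pair_vectors_moments:
  shows "real (card pair_vectors) = 1104"
    and "(\<Sum>b\<in>pair_vectors. (\<Sum>i\<in>UNIV. a i * real_of_int (b i))\<^sup>2) = 1472 * (\<Sum>i\<in>UNIV. (a i)\<^sup>2)"
    and "(\<Sum>b\<in>pair_vectors. (\<Sum>i\<in>UNIV. a i * real_of_int (b i)) ^ 4) =
      3072 * (\<Sum>i\<in>UNIV. (a i)\<^sup>2)\<^sup>2 + 20480 * (\<Sum>i\<in>UNIV. a i ^ 4)"
proof -
  have "card {P \<in> {P. card P = 2}. i \<in> P} = 23" for i :: coord
  proof -
    have "{P \<in> {P. card P = 2}. i \<in> P} = (\<lambda>j. {i, j}) ` (UNIV - {i})"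
      by (auto simp: card_2_iff)
    moreover have "inj_on (\<lambda>j. {i, j}) (UNIV - {i})"
      by (auto simp: inj_on_def doubleton_eq_iff)
    ultimately show ?thesis by (simp add: card_image card_Diff_singleton)
  qed
  moreover have "card {P \<in> {P. card P = 2}. i \<in> P \<and> j \<in> P} = 1" if "i \<noteq> j" for i j :: coord
  proof -
    have "{P \<in> {P. card P = 2}. i \<in> P \<and> j \<in> P} = {{i, j}}"
      using that by (auto simp: card_2_iff)
    then show ?thesis by simp
  qed
  ultimately have d: "design {P. card P = 2} 23 1"
    by (simp add: design_def)
  have o: "orthogonal_signs 4 (Pow P) P" for P :: "coord set"
    by (intro subsets_orthogonal_signs) simp
  have c: "card (Pow P) = 4" if "P \<in> {P. card P = 2}" for P :: "coord set"
    using that by (simp add: card_Pow)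
  have n: "card {P :: coord set. card P = 2} = 276"
    using n_subsets[of "UNIV :: coord set" 2] by (simp add: choose_two)
  note moments = signed_design_moments[where t = 4, OF _ d o c, folded pair_vectors_def]
  show "real (card pair_vectors) = 1104"
    "(\<Sum>b\<in>pair_vectors. (\<Sum>i\<in>UNIV. a i * real_of_int (b i))\<^sup>2) = 1472 * (\<Sum>i\<in>UNIV. (a i)\<^sup>2)"
    "(\<Sum>b\<in>pair_vectors. (\<Sum>i\<in>UNIV. a i * real_of_int (b i)) ^ 4) =
      3072 * (\<Sum>i\<in>UNIV. (a i)\<^sup>2)\<^sup>2 + 20480 * (\<Sum>i\<in>UNIV. a i ^ 4)"
    by (subst moments; simp add: n)+
qed

text \<open>The entry -3 gives the vector for the empty codeword the coordinate sum 20, which is 4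
  modulo 8 as required of odd lattice vectors with m = 1.\<close>

definition full_vector :: "coord set \<Rightarrow> coord \<Rightarrow> coord \<Rightarrow> int" where
  "full_vector c p i = (if i \<in> c then - 1 else 1) * (if i = p then - 3 else 1)"

definition full_vectors :: "(coord \<Rightarrow> int) set" where
  "full_vectors = (\<lambda>(p, c). full_vector c p) ` (UNIV \<times> golay_code)"

lemma sum_full_vectors:
  "(\<Sum>b\<in>full_vectors. h b) = (\<Sum>p\<in>UNIV. \<Sum>c\<in>golay_code. h (full_vector c p))"
proof -
  have "inj_on (\<lambda>(p, c). full_vector c p) (UNIV \<times> golay_code)"
  proof (rule inj_onI, clarify)
    fix p c p' c' assume *: "full_vector c p = full_vector c' p'"
    have S: "{i. \<bar>full_vector c p i\<bar> = 3} = {p}"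
      "{i. full_vector c p i \<in> {-1, 3}} = c" for c p
      by (auto simp: full_vector_def split: if_splits)
    show "p = p' \<and> c = c'" using S(1)[of c p] S(1)[of c' p'] S(2)[of c p] S(2)[of c' p'] * by simp
  qed
  then show ?thesis
    unfolding full_vectors_def by (simp add: sum.reindex sum.cartesian_product case_prod_unfold)
qed

text \<open>For fixed p the code acts as a sign array of strength 7 on \<open>z p\<close>, which is
  \<open>a\<close> with coordinate p scaled by -3; hence 9 = 1 + 8 and 81 = 1 + 80. The quartic
  coefficient -65536 cancels 45056 + 20480 from the other two shapes.\<close>

lemma full_vectors_moments:
  shows "real (card full_vectors) = 98304"
    and "(\<Sum>b\<in>full_vectors. (\<Sum>i\<in>UNIV. a i * real_of_int (b i))\<^sup>2) = 131072 * (\<Sum>i\<in>UNIV. (a i)\<^sup>2)"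
    and "(\<Sum>b\<in>full_vectors. (\<Sum>i\<in>UNIV. a i * real_of_int (b i)) ^ 4) =
      491520 * (\<Sum>i\<in>UNIV. (a i)\<^sup>2)\<^sup>2 - 65536 * (\<Sum>i\<in>UNIV. a i ^ 4)"
proof -
  have "real (card full_vectors) = (\<Sum>p\<in>(UNIV :: coord set). \<Sum>c\<in>golay_code. 1)"
    unfolding sum_full_vectors[of "\<lambda>_. 1", symmetric] by simp
  then show "real (card full_vectors) = 98304" by (simp add: card_golay_code)
  define z where "z p i = a i * (if i = p then - 3 else 1)" for p i
  have inner: "(\<Sum>i\<in>UNIV. a i * real_of_int (full_vector c p i)) = (\<Sum>i\<in>UNIV. sign_at c i * z p i)" for c p
    by (rule sum.cong) (auto simp: full_vector_def sign_at_def z_def)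
  have z2: "(\<Sum>i\<in>UNIV. (z p i)\<^sup>2) = (\<Sum>i\<in>UNIV. (a i)\<^sup>2) + 8 * (a p)\<^sup>2" for p
  proof -
    have "(\<Sum>i\<in>UNIV. (z p i)\<^sup>2) = (\<Sum>i\<in>UNIV. (a i)\<^sup>2 + (if i = p then 8 * (a p)\<^sup>2 else 0))"
      by (rule sum.cong) (auto simp: z_def power_mult_distrib)
    then show ?thesis by (simp add: sum.distrib)
  qed
  have z4: "(\<Sum>i\<in>UNIV. z p i ^ 4) = (\<Sum>i\<in>UNIV. a i ^ 4) + 80 * a p ^ 4" for p
  proof -
    have "(\<Sum>i\<in>UNIV. z p i ^ 4) = (\<Sum>i\<in>UNIV. a i ^ 4 + (if i = p then 80 * a p ^ 4 else 0))"
      by (rule sum.cong) (auto simp: z_def power_mult_distrib)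
    then show ?thesis by (simp add: sum.distrib)
  qed
  show "(\<Sum>b\<in>full_vectors. (\<Sum>i\<in>UNIV. a i * real_of_int (b i))\<^sup>2) = 131072 * (\<Sum>i\<in>UNIV. (a i)\<^sup>2)"
    unfolding sum_full_vectors inner
    by (simp add: orthogonal_signs_second_moment[OF golay_orthogonal_signs] card_golay_code z2
        sum.distrib flip: sum_distrib_left)
  have "(\<Sum>b\<in>full_vectors. (\<Sum>i\<in>UNIV. a i * real_of_int (b i)) ^ 4)
      = (\<Sum>p\<in>UNIV. 4096 * (3 * ((\<Sum>i\<in>UNIV. (a i)\<^sup>2) + 8 * (a p)\<^sup>2)\<^sup>2 - 2 * ((\<Sum>i\<in>UNIV. a i ^ 4) + 80 * a p ^ 4)))"
    unfolding sum_full_vectors inner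
    by (simp add: orthogonal_signs_fourth_moment[OF golay_orthogonal_signs] card_golay_code z2 z4)
  also have "\<dots> = (\<Sum>p\<in>UNIV. 12288 * (\<Sum>i\<in>UNIV. (a i)\<^sup>2)\<^sup>2 - 8192 * (\<Sum>i\<in>UNIV. a i ^ 4)
      + 196608 * (\<Sum>i\<in>UNIV. (a i)\<^sup>2) * (a p)\<^sup>2 + 131072 * a p ^ 4)"
    by (rule sum.cong) (simp_all, algebra)
  also have "\<dots> = 491520 * (\<Sum>i\<in>UNIV. (a i)\<^sup>2)\<^sup>2 - 65536 * (\<Sum>i\<in>UNIV. a i ^ 4)"
    by (simp add: sum.distrib power2_eq_square flip: sum_distrib_left)
  finally show "(\<Sum>b\<in>full_vectors. (\<Sum>i\<in>UNIV. a i * real_of_int (b i)) ^ 4) =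
      491520 * (\<Sum>i\<in>UNIV. (a i)\<^sup>2)\<^sup>2 - 65536 * (\<Sum>i\<in>UNIV. a i ^ 4)" .
qed

section \<open>The Leech lattice\<close>

definition leech_coords :: "(coord \<Rightarrow> int) set" where
  "leech_coords = {a. \<exists>m. (\<forall>i. [a i = m] (mod 2)) \<and> [(\<Sum>i\<in>UNIV. a i) = 4 * m] (mod 8) \<and>
     (\<forall>k. {i. [a i = k] (mod 4)} \<in> golay_code)}"

definition leech_vector :: "(coord \<Rightarrow> int) \<Rightarrow> real ^ coord" where
  "leech_vector a = (\<chi> i. real_of_int (a i) / sqrt 8)"

lemma leech_lattice_eq: "leech_lattice = leech_vector ` leech_coords"
  by (auto simp: leech_lattice_def leech_coords_def leech_vector_def)

lemma inner_leech_vector: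
  "leech_vector a \<bullet> leech_vector b = real_of_int (\<Sum>i\<in>UNIV. a i * b i) / 8"
  by (simp add: leech_vector_def inner_vec_def sum_divide_distrib)

lemma leech_vector_eq_iff: "leech_vector a = leech_vector b \<longleftrightarrow> a = b"
  by (auto simp: leech_vector_def vec_eq_iff)

text \<open>One residue class modulo 4 decides all four: k = m + 2 gives the complement, and k of
  the other parity gives the empty set.\<close>

lemma golay_code_congruence_classes:
  fixes a :: "coord \<Rightarrow> int" and k m :: int
  assumes "\<forall>i. [a i = m] (mod 2)" "{i. [a i = m] (mod 4)} \<in> golay_code"
  shows "{i. [a i = k] (mod 4)} \<in> golay_code"
proof -
  have a: "2 dvd a i - m" for i using assms(1) by (simp add: cong_iff_dvd_diff)
  have "4 dvd k - m \<or> 4 dvd k - m - 2 \<or> \<not> 2 dvd k - m" by presburger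
  then consider "4 dvd k - m" | "4 dvd k - m - 2" | "\<not> 2 dvd k - m" by blast
  then show ?thesis
  proof cases
    case 1
    then have "[k = m] (mod 4)" by (simp add: cong_iff_dvd_diff)
    then have "{i. [a i = k] (mod 4)} = {i. [a i = m] (mod 4)}" by (simp add: cong_def)
    with assms(2) show ?thesis by simp
  next
    case 2
    have "4 dvd a i - k \<longleftrightarrow> \<not> 4 dvd a i - m" for i
    proof -
      obtain s where "a i - m = 2 * s" using a[of i] by blast
      moreover obtain t where "k - m - 2 = 4 * t" using 2 by blast
      ultimately have "a i - k = 2 * s - 2 - 4 * t" "a i - m = 2 * s" by linarith+
      then show ?thesis by presburger
    qed
    then have "{i. [a i = k] (mod 4)} = - {i. [a i = m] (mod 4)}"
      by (auto simp: cong_iff_dvd_diff)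
    with assms(2) show ?thesis by (simp add: compl_in_golay_code)
  next
    case 3
    have "\<not> [a i = k] (mod 4)" for i
    proof
      assume "[a i = k] (mod 4)"
      then have "4 dvd a i - k" by (simp add: cong_iff_dvd_diff)
      then have "2 dvd a i - k" by (rule dvd_trans[rotated]) simp
      with a[of i] have "2 dvd (a i - m) - (a i - k)" by (rule dvd_diff)
      with 3 show False by simp
    qed
    then show ?thesis by (simp add: golay_code.empty)
  qed
qed

text \<open>Modulo 4 the entries of \<open>a\<close> take only the values m and m + 2, those of
  \<open>b\<close> only n and n + 2. The class of m - n is therefore where both or neither take the
  first value, the complement of a symmetric difference of codewords.\<close>

lemma leech_coords_diff:
  assumes "a \<in> leech_coords" "b \<in> leech_coords"
  shows "(\<lambda>i. a i - b i) \<in> leech_coords"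
proof -
  obtain m where m: "\<forall>i. [a i = m] (mod 2)" "[(\<Sum>i\<in>UNIV. a i) = 4 * m] (mod 8)"
      "{i. [a i = m] (mod 4)} \<in> golay_code"
    using assms(1) by (auto simp: leech_coords_def)
  obtain n where n: "\<forall>i. [b i = n] (mod 2)" "[(\<Sum>i\<in>UNIV. b i) = 4 * n] (mod 8)"
      "{i. [b i = n] (mod 4)} \<in> golay_code"
    using assms(2) by (auto simp: leech_coords_def)
  have "[a i - b i = m - n] (mod 4) \<longleftrightarrow> ([a i = m] (mod 4) \<longleftrightarrow> [b i = n] (mod 4))" for i
  proof -
    have "2 dvd a i - m" "2 dvd b i - n" using m(1) n(1) by (simp_all add: cong_iff_dvd_diff)
    then obtain s t where "a i - m = 2 * s" "b i - n = 2 * t" by blast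
    moreover from this have "a i - b i - (m - n) = 2 * s - 2 * t" by linarith
    moreover have "4 dvd 2 * s - 2 * t \<longleftrightarrow> (4 dvd 2 * s \<longleftrightarrow> 4 dvd 2 * t)" by presburger
    ultimately show ?thesis by (simp only: cong_iff_dvd_diff)
  qed
  then have "{i. [a i - b i = m - n] (mod 4)} = - sym_diff {i. [a i = m] (mod 4)} {i. [b i = n] (mod 4)}"
    by auto
  then have "{i. [a i - b i = m - n] (mod 4)} \<in> golay_code"
    using compl_in_golay_code[OF sym_diff_in_golay_code[OF n(3) m(3)]] by simp
  moreover have "\<forall>i. [a i - b i = m - n] (mod 2)"
    using m(1) n(1) by (simp add: cong_diff)
  moreover have "[(\<Sum>i\<in>UNIV. a i - b i) = 4 * (m - n)] (mod 8)"
    using cong_diff[OF m(2) n(2)] by (simp add: sum_subtractf right_diff_distrib)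
  ultimately show ?thesis
    unfolding leech_coords_def using golay_code_congruence_classes[of "\<lambda>i. a i - b i"] by blast
qed

lemma sum_mod_eqI: "(\<And>i. f i mod n = g i mod n) \<Longrightarrow> sum f A mod n = sum g A mod (n :: int)"
  using cong_sum[of A f g n] by (simp add: cong_def)

text \<open>The lattice is even: 16 in integer coordinates is squared norm 2. The classes modulo 4
  have sizes divisible by 4, and the odd case also draws on the condition on the coordinate
  sum.\<close>

lemma sum_square_mod_16:
  assumes "a \<in> leech_coords"
  shows "(\<Sum>i\<in>UNIV. (a i)\<^sup>2) mod 16 = 0"
proof -
  obtain m where m: "\<forall>i. [a i = m] (mod 2)" "[(\<Sum>i\<in>UNIV. a i) = 4 * m] (mod 8)"
    and golay: "\<And>k. {i. [a i = k] (mod 4)} \<in> golay_code"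
    using assms by (auto simp: leech_coords_def)
  have four: "4 dvd card {i. [a i = k] (mod 4)}" for k
    by (rule golay_code_doubly_even[OF golay])
  have card_sum: "(\<Sum>i\<in>UNIV. if [a i = k] (mod 4) then c else 0) = c * int (card {i. [a i = k] (mod 4)})" for c k
    by (simp add: sum.If_cases)
  show ?thesis
  proof (cases "even m")
    case True
    have "(a i)\<^sup>2 mod 16 = (if [a i = 2] (mod 4) then 4 else 0) mod 16" for i
    proof -
      have "even (a i)" using m(1) True by (metis cong_dvd_iff)
      then have "a i = 4 * (a i div 4) \<or> a i = 4 * (a i div 4) + 2" by presburger
      then consider z where "a i = 4 * z" | z where "a i = 4 * z + 2" by blast
      then show ?thesis
      proof cases
        case (1 z)
        have "(a i)\<^sup>2 = 16 * z\<^sup>2" by (simp add: 1 power2_eq_square)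
        moreover have "\<not> [a i = 2] (mod 4)" unfolding cong_def 1 by presburger
        ultimately show ?thesis by simp
      next
        case (2 z)
        have "(a i)\<^sup>2 = 16 * (z\<^sup>2 + z) + 4" by (simp add: 2 power2_eq_square algebra_simps)
        moreover have "[a i = 2] (mod 4)" unfolding cong_def 2 by presburger
        ultimately show ?thesis by (simp only: if_True mod_mult_self4)
      qed
    qed
    then have "(\<Sum>i\<in>UNIV. (a i)\<^sup>2) mod 16 = (\<Sum>i\<in>UNIV. if [a i = 2] (mod 4) then 4 else 0) mod 16"
      by (rule sum_mod_eqI)
    moreover obtain q where "card {i. [a i = 2] (mod 4)} = 4 * q" using four[of 2] by blast
    ultimately show ?thesis by (simp add: card_sum)
  next
    case False
    then obtain l where l: "m = 2 * l + 1" by (elim oddE)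
    obtain u where u: "(\<Sum>i\<in>UNIV. a i) - 4 * m = 8 * u"
      using m(2) unfolding cong_iff_dvd_diff by blast
    \<comment> \<open>Linear form of an odd square: (4z + 1)^2 is 8z + 1 and (4z + 3)^2 is 8z + 9
      modulo 16, so the sum of squares reduces to the coordinate sum.\<close>
    have "(a i)\<^sup>2 mod 16 = (2 * a i - 1 + (if [a i = 3] (mod 4) then 4 else 0)) mod 16" for i
    proof -
      have "odd (a i)" using m(1) False by (metis cong_dvd_iff)
      then have "a i = 4 * (a i div 4) + 1 \<or> a i = 4 * (a i div 4) + 3" by presburger
      then consider z where "a i = 4 * z + 1" | z where "a i = 4 * z + 3" by blast
      then show ?thesis
      proof cases
        case (1 z)
        have "(a i)\<^sup>2 = 16 * z\<^sup>2 + (8 * z + 1)" by (simp add: 1 power2_eq_square algebra_simps)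
        moreover have "\<not> [a i = 3] (mod 4)" unfolding cong_def 1 by presburger
        moreover have "2 * a i - 1 + 0 = 8 * z + 1" using 1 by simp
        ultimately show ?thesis by (simp only: if_False mod_mult_self4)
      next
        case (2 z)
        have "(a i)\<^sup>2 = 16 * (z\<^sup>2 + z) + (8 * z + 9)" by (simp add: 2 power2_eq_square algebra_simps)
        moreover have "[a i = 3] (mod 4)" unfolding cong_def 2 by presburger
        moreover have "2 * a i - 1 + 4 = 8 * z + 9" using 2 by simp
        ultimately show ?thesis by (simp only: if_True mod_mult_self4)
      qed
    qed
    then have "(\<Sum>i\<in>UNIV. (a i)\<^sup>2) mod 16 =
        (\<Sum>i\<in>UNIV. 2 * a i - 1 + (if [a i = 3] (mod 4) then 4 else 0)) mod 16"
      by (rule sum_mod_eqI)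
    also have "(\<Sum>i\<in>UNIV. 2 * a i - 1 + (if [a i = 3] (mod 4) then 4 else 0)) =
        2 * (\<Sum>i\<in>UNIV. a i) - 24 + 4 * int (card {i. [a i = 3] (mod 4)})"
      by (simp add: sum.distrib sum_subtractf card_sum flip: sum_distrib_left)
    also obtain q where "card {i. [a i = 3] (mod 4)} = 4 * q" using four[of 3] by blast
    also have "2 * (\<Sum>i\<in>UNIV. a i) - 24 + 4 * int (4 * q) = 16 * (l + u + int q - 1)"
      using l u by simp
    finally show ?thesis by simp
  qed
qed

text \<open>Each type reaches 32 differently: 9 + 23 for odd entries, 8 * 4 if some entry is 2
  modulo 4, and 16 + 16 or 64 if all are divisible by 4. The sum condition excludes the shorter
  candidates, all entries 1 or -1 and a single entry 4 or -4.\<close>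

lemma sum_square_ge_32:
  assumes "a \<in> leech_coords" "a \<noteq> (\<lambda>_. 0)"
  shows "32 \<le> (\<Sum>i\<in>UNIV. (a i)\<^sup>2)"
proof -
  obtain m where m: "\<forall>i. [a i = m] (mod 2)" "[(\<Sum>i\<in>UNIV. a i) = 4 * m] (mod 8)"
    and golay: "\<And>k. {i. [a i = k] (mod 4)} \<in> golay_code"
    using assms(1) by (auto simp: leech_coords_def)
  have square: "n\<^sup>2 \<le> x\<^sup>2" if "n \<le> \<bar>x\<bar>" "0 \<le> n" for x n :: int
    using that by (metis abs_of_nonneg abs_le_square_iff)
  show ?thesis
  proof (cases "even m")
    case False
    then have odd: "odd (a i)" for i using m(1) by (metis cong_dvd_iff)
    have one: "1 \<le> (a i)\<^sup>2" for i
      using square[of 1 "a i"] odd[of i] by (cases "a i = 0") auto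
    obtain p where p: "3 \<le> \<bar>a p\<bar>"
    proof (rule ccontr)
      assume "\<not> thesis"
      then have small: "\<bar>a i\<bar> < 3" for i using that by (meson not_le)
      have "a i = 1 - 2 * (if [a i = 3] (mod 4) then 1 else 0)" for i
      proof -
        have "a i = 1 \<or> a i = -1" using odd[of i] small[of i] by presburger
        then show ?thesis by (auto simp: cong_def)
      qed
      then have "(\<Sum>i\<in>UNIV. a i) = (\<Sum>i\<in>UNIV. 1 - 2 * (if [a i = 3] (mod 4) then 1 else 0))"
        by (rule sum.cong[OF refl])
      also have "\<dots> = 24 - 2 * int (card {i. [a i = 3] (mod 4)})"
        by (simp add: sum_subtractf sum.If_cases flip: sum_distrib_left)
      also obtain q where "card {i. [a i = 3] (mod 4)} = 4 * q"
        using golay_code_doubly_even[OF golay[of 3]] by blast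
      \<comment> \<open>With all entries 1 or -1 the sum is 24 - 8q, a multiple of 8, whereas 4m
        with m odd is not.\<close>
      finally have "8 dvd 24 - 8 * int q - 4 * m"
        using m(2) by (simp add: cong_iff_dvd_diff)
      with False show False by presburger
    qed
    have "32 = (\<Sum>i\<in>(UNIV :: coord set). 1 + (if i = p then 8 else 0 :: int))"
      by (simp add: sum.distrib)
    also have "\<dots> \<le> (\<Sum>i\<in>UNIV. (a i)\<^sup>2)"
      using one square[OF p] by (intro sum_mono) auto
    finally show ?thesis .
  next
    case True
    then have even: "even (a i)" for i using m(1) by (metis cong_dvd_iff)
    let ?A = "{i. [a i = 2] (mod 4)}"
    show ?thesis
    proof (cases "?A = {}")
      case False
      then have "8 \<le> card ?A"
        using golay_code_card[OF golay[of 2]] by (auto simp: card_gt_0_iff)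
      then have "32 \<le> (\<Sum>i\<in>?A. 4 :: int)" by simp
      also have "\<dots> \<le> (\<Sum>i\<in>?A. (a i)\<^sup>2)"
      proof (rule sum_mono)
        fix i assume "i \<in> ?A"
        then have "a i mod 4 = 2" by (simp add: cong_def)
        then have "2 \<le> \<bar>a i\<bar>" by presburger
        from square[OF this] show "4 \<le> (a i)\<^sup>2" by simp
      qed
      also have "\<dots> \<le> (\<Sum>i\<in>UNIV. (a i)\<^sup>2)"
        by (rule sum_mono2) auto
      finally show ?thesis .
    next
      case True
      have four: "4 dvd a i" for i
      proof -
        have "a i mod 4 \<noteq> 2" using True by (auto simp: cong_def)
        then show ?thesis using even[of i] by presburger
      qed
      have ge: "16 \<le> (a i)\<^sup>2" if "a i \<noteq> 0" for i
      proof -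
        have "4 \<le> \<bar>a i\<bar>" using that four[of i] by presburger
        from square[OF this] show ?thesis by simp
      qed
      obtain p where p: "a p \<noteq> 0" using assms(2) by blast
      show ?thesis
      proof (cases "\<exists>q. q \<noteq> p \<and> a q \<noteq> 0")
        case True
        then obtain q where q: "q \<noteq> p" "a q \<noteq> 0" by blast
        have "32 \<le> (\<Sum>i\<in>{p, q}. (a i)\<^sup>2)" using ge[OF p] ge[OF q(2)] q(1) by simp
        also have "\<dots> \<le> (\<Sum>i\<in>UNIV. (a i)\<^sup>2)" by (rule sum_mono2) auto
        finally show ?thesis .
      next
        case False
        then have "a i = (if i = p then a p else 0)" for i by auto
        then have "(\<Sum>i\<in>UNIV. a i) = (\<Sum>i\<in>UNIV. if i = p then a p else 0)"
          by (rule sum.cong[OF refl])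
        then have "(\<Sum>i\<in>UNIV. a i) = a p" by simp
        then have "8 dvd a p - 4 * m" using m(2) by (simp add: cong_iff_dvd_diff)
        then have "8 dvd a p" using \<open>even m\<close> by presburger
        then have "8 \<le> \<bar>a p\<bar>" using p by presburger
        from square[OF this] have "32 \<le> (\<Sum>i\<in>{p}. (a i)\<^sup>2)" by simp
        also have "\<dots> \<le> (\<Sum>i\<in>UNIV. (a i)\<^sup>2)" by (rule sum_mono2) auto
        finally show ?thesis .
      qed
    qed
  qed
qed

lemma leech_coordsI:
  assumes "\<forall>i. [a i = m] (mod 2)" "[(\<Sum>i\<in>UNIV. a i) = 4 * m] (mod 8)" "{i. [a i = m] (mod 4)} \<in> golay_code"
  shows "a \<in> leech_coords"
  unfolding leech_coords_def using assms golay_code_congruence_classes[of a m] by blast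

lemma sum_signed:
  assumes "E \<subseteq> S"
  shows "(\<Sum>i\<in>UNIV. signed t S E i) = t * (int (card S) - 2 * int (card E))"
    and "(\<Sum>i\<in>UNIV. (signed t S E i)\<^sup>2) = t\<^sup>2 * int (card S)"
proof -
  have "(\<Sum>i\<in>UNIV. signed t S E i) = (\<Sum>i\<in>UNIV. (if i \<in> S then t else 0) - (if i \<in> E then 2 * t else 0))"
    by (rule sum.cong) (use assms in \<open>auto simp: signed_def\<close>)
  then show "(\<Sum>i\<in>UNIV. signed t S E i) = t * (int (card S) - 2 * int (card E))"
    by (simp add: sum_subtractf sum.If_cases algebra_simps)
  have "(\<Sum>i\<in>UNIV. (signed t S E i)\<^sup>2) = (\<Sum>i\<in>UNIV. if i \<in> S then t\<^sup>2 else 0)"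
    by (rule sum.cong) (auto simp: signed_def)
  then show "(\<Sum>i\<in>UNIV. (signed t S E i)\<^sup>2) = t\<^sup>2 * int (card S)"
    by (simp add: sum.If_cases)
qed

lemma octad_vectors_leech:
  assumes "b \<in> octad_vectors"
  shows "b \<in> leech_coords" "(\<Sum>i\<in>UNIV. (b i)\<^sup>2) = 32"
proof -
  obtain B E where B: "B \<in> golay_code" "card B = 8" "E \<subseteq> B" "even (card E)" "b = signed 2 B E"
    using assms by (auto simp: octad_vectors_def signed_design_def octads_def)
  show "(\<Sum>i\<in>UNIV. (b i)\<^sup>2) = 32" using B by (simp add: sum_signed)
  show "b \<in> leech_coords"
  proof (rule leech_coordsI[where m = 0])
    show "\<forall>i. [b i = 0] (mod 2)" by (simp add: B signed_def cong_def)
    obtain k where "card E = 2 * k" using B(4) by blast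
    then have "2 * (int (card B) - 2 * int (card E)) = 8 * (2 - int k)" using B(2) by simp
    then show "[(\<Sum>i\<in>UNIV. b i) = 4 * 0] (mod 8)"
      unfolding B(5) sum_signed(1)[OF B(3)] cong_def by simp
    have "{i. [b i = 0] (mod 4)} = - B" by (auto simp: B signed_def cong_def)
    then show "{i. [b i = 0] (mod 4)} \<in> golay_code" using B(1) by (simp add: compl_in_golay_code)
  qed
qed

lemma pair_vectors_leech:
  assumes "b \<in> pair_vectors"
  shows "b \<in> leech_coords" "(\<Sum>i\<in>UNIV. (b i)\<^sup>2) = 32"
proof -
  obtain P E where P: "card P = 2" "E \<subseteq> P" "b = signed 4 P E"
    using assms by (auto simp: pair_vectors_def signed_design_def)
  show "(\<Sum>i\<in>UNIV. (b i)\<^sup>2) = 32" using P by (simp add: sum_signed)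
  show "b \<in> leech_coords"
  proof (rule leech_coordsI[where m = 0])
    show "\<forall>i. [b i = 0] (mod 2)" by (simp add: P signed_def cong_def)
    show "[(\<Sum>i\<in>UNIV. b i) = 4 * 0] (mod 8)"
      unfolding P(3) sum_signed(1)[OF P(2)] P(1) cong_def by simp
    have "{i. [b i = 0] (mod 4)} = UNIV" by (auto simp: P signed_def cong_def)
    then show "{i. [b i = 0] (mod 4)} \<in> golay_code" by (simp add: UNIV_in_golay_code)
  qed
qed

lemma full_vectors_leech:
  assumes "b \<in> full_vectors"
  shows "b \<in> leech_coords" "(\<Sum>i\<in>UNIV. (b i)\<^sup>2) = 32"
proof -
  obtain c p where c: "c \<in> golay_code" "b = full_vector c p"
    using assms by (auto simp: full_vectors_def)
  have "(\<Sum>i\<in>UNIV. (b i)\<^sup>2) = (\<Sum>i\<in>UNIV. 1 + (if i = p then 8 else 0))"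
    by (rule sum.cong) (auto simp: c full_vector_def)
  then show "(\<Sum>i\<in>UNIV. (b i)\<^sup>2) = 32" by (simp add: sum.distrib)
  show "b \<in> leech_coords"
  proof (rule leech_coordsI[where m = 1])
    show "\<forall>i. [b i = 1] (mod 2)" by (simp add: c full_vector_def cong_def)
    have "(\<Sum>i\<in>UNIV. b i) = (\<Sum>i\<in>UNIV. 1 - (if i \<in> c then 2 else 0) - (if i = p then if p \<in> c then - 4 else 4 else 0))"
      by (rule sum.cong) (auto simp: c full_vector_def)
    also have "\<dots> = 24 - 2 * int (card c) - (if p \<in> c then - 4 else 4)"
      by (simp add: sum_subtractf sum.If_cases)
    also obtain q where "card c = 4 * q" using golay_code_doubly_even[OF c(1)] by blast
    finally have "(\<Sum>i\<in>UNIV. b i) - 4 * 1 = 8 * (if p \<in> c then 3 - int q else 2 - int q)"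
      by simp
    then show "[(\<Sum>i\<in>UNIV. b i) = 4 * 1] (mod 8)"
      unfolding cong_iff_dvd_diff by (metis dvd_triv_left)
    have "{i. [b i = 1] (mod 4)} = - c" by (auto simp: c full_vector_def cong_def)
    then show "{i. [b i = 1] (mod 4)} \<in> golay_code" using c(1) by (simp add: compl_in_golay_code)
  qed
qed

section \<open>The minimal vectors of the Leech lattice\<close>

definition leech_shell :: "(coord \<Rightarrow> int) set" where
  "leech_shell = {a \<in> leech_coords. (\<Sum>i\<in>UNIV. (a i)\<^sup>2) = 32}"

lemma power2_norm_leech_vector: "(norm (leech_vector a))\<^sup>2 = real_of_int (\<Sum>i\<in>UNIV. (a i)\<^sup>2) / 8"
  unfolding power2_norm_eq_inner inner_leech_vector by (simp add: power2_eq_square)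

lemma norm_leech_vector:
  assumes "a \<in> leech_shell"
  shows "norm (leech_vector a) = 2"
proof (rule power2_eq_imp_eq)
  have "(\<Sum>i\<in>UNIV. (a i)\<^sup>2) = 32" using assms by (simp add: leech_shell_def)
  then show "(norm (leech_vector a))\<^sup>2 = 2\<^sup>2" unfolding power2_norm_leech_vector by simp
qed simp_all

lemma shapes_in_leech_shell: "octad_vectors \<union> pair_vectors \<union> full_vectors \<subseteq> leech_shell"
  using octad_vectors_leech pair_vectors_leech full_vectors_leech by (auto simp: leech_shell_def)

text \<open>\<open>sum_square_ge_32\<close> bounds the norm of nonzero lattice vectors below by 2,
  and a vector of one of the shapes attains this.\<close>

lemma minimal_vectors_leech: "minimal_vectors leech_lattice = leech_vector ` leech_shell"
proof -
  note sq = power2_norm_leech_vector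
  have zero: "leech_vector a = 0 \<longleftrightarrow> a = (\<lambda>_. 0)" for a
    by (auto simp: leech_vector_def vec_eq_iff)
  have ge: "2 \<le> norm (leech_vector a)" if "a \<in> leech_coords" "leech_vector a \<noteq> 0" for a
  proof -
    have "32 \<le> (\<Sum>i\<in>UNIV. (a i)\<^sup>2)"
      using sum_square_ge_32[OF that(1)] that(2) zero by blast
    then have "32 \<le> real_of_int (\<Sum>i\<in>UNIV. (a i)\<^sup>2)" by linarith
    then have "2\<^sup>2 \<le> (norm (leech_vector a))\<^sup>2" unfolding sq by (simp del: of_int_sum)
    then show ?thesis by (rule power2_le_imp_le) simp
  qed
  have "pair_vectors \<noteq> {}" using pair_vectors_moments(1) by auto
  then obtain b where b: "b \<in> leech_shell" using shapes_in_leech_shell by blast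
  have two: "leech_vector a \<noteq> 0" if "a \<in> leech_shell" for a
    using norm_leech_vector[OF that] by auto
  show ?thesis
  proof (intro equalityI subsetI)
    fix v assume v: "v \<in> minimal_vectors leech_lattice"
    then obtain a where a: "a \<in> leech_coords" "v = leech_vector a"
      by (auto simp: minimal_vectors_def leech_lattice_eq)
    have "b \<in> leech_coords" using b by (simp add: leech_shell_def)
    then have "norm v \<le> norm (leech_vector b)"
      using v two[OF b] by (auto simp: minimal_vectors_def leech_lattice_eq)
    moreover have "2 \<le> norm v" using v ge a by (simp add: minimal_vectors_def)
    ultimately have "norm v = 2" using norm_leech_vector[OF b] by simp
    then have "real_of_int (\<Sum>i\<in>UNIV. (a i)\<^sup>2) = 32" using sq[of a] a(2) by (simp del: of_int_sum)
    then have "(\<Sum>i\<in>UNIV. (a i)\<^sup>2) = 32" by linarith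
    then show "v \<in> leech_vector ` leech_shell" using a by (simp add: leech_shell_def)
  next
    fix v assume "v \<in> leech_vector ` leech_shell"
    then obtain a where a: "a \<in> leech_shell" "v = leech_vector a" by blast
    then show "v \<in> minimal_vectors leech_lattice"
      using two[OF a(1)] norm_leech_vector[OF a(1)] ge
      by (auto simp: minimal_vectors_def leech_lattice_eq leech_shell_def)
  qed
qed

lemma leech_shell_minus:
  assumes "a \<in> leech_shell"
  shows "(\<lambda>i. - a i) \<in> leech_shell"
proof -
  have "a \<in> leech_coords" using assms by (simp add: leech_shell_def)
  \<comment> \<open>The negative is obtained as (a - a) - a.\<close>
  from leech_coords_diff[OF leech_coords_diff[OF this this] this] show ?thesis
    using assms by (simp add: leech_shell_def)
qed

text \<open>The square sum of a - b is 64 - 2 (a . b); it is at least 32 because a - b is a nonzero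
  lattice vector, and divisible by 16 because the lattice is even.\<close>

lemma leech_shell_inner_le:
  assumes ab: "a \<in> leech_shell" "b \<in> leech_shell" "a \<noteq> b"
  shows "\<exists>k :: int. k \<le> 2 \<and> (\<Sum>i\<in>UNIV. a i * b i) = 8 * k"
proof -
  have coords: "a \<in> leech_coords" "b \<in> leech_coords"
    and norms: "(\<Sum>i\<in>UNIV. (a i)\<^sup>2) = 32" "(\<Sum>i\<in>UNIV. (b i)\<^sup>2) = 32"
    using ab by (auto simp: leech_shell_def)
  note d = leech_coords_diff[OF coords]
  have "(\<lambda>i. a i - b i) \<noteq> (\<lambda>_. 0)" using ab(3) by (auto simp: fun_eq_iff)
  then have ge: "32 \<le> (\<Sum>i\<in>UNIV. (a i - b i)\<^sup>2)" using sum_square_ge_32[OF d] by simp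
  have eq: "(\<Sum>i\<in>UNIV. (a i - b i)\<^sup>2) = 64 - 2 * (\<Sum>i\<in>UNIV. a i * b i)"
    using norms by (simp add: power2_diff sum.distrib sum_subtractf mult.assoc flip: sum_distrib_left)
  obtain q where "(\<Sum>i\<in>UNIV. (a i - b i)\<^sup>2) = 16 * q"
    using sum_square_mod_16[OF d] by (auto simp flip: dvd_eq_mod_eq_0 elim: dvdE)
  then show ?thesis using ge eq by (intro exI[of _ "4 - q"]) auto
qed

text \<open>The one-sided bound for a and for -a together gives the two-sided one.\<close>

lemma leech_shell_inner:
  assumes ab: "a \<in> leech_shell" "b \<in> leech_shell"
  shows "leech_vector a \<bullet> leech_vector b \<in> {-2, -1, 0, 1, 2} \<or> b = a \<or> b = (\<lambda>i. - a i)"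
proof (cases "b = a \<or> b = (\<lambda>i. - a i)")
  case False
  obtain k where k: "k \<le> 2" "(\<Sum>i\<in>UNIV. a i * b i) = 8 * k"
    using leech_shell_inner_le[OF ab] False by blast
  obtain l where l: "l \<le> 2" "(\<Sum>i\<in>UNIV. - a i * b i) = 8 * l"
    using leech_shell_inner_le[OF leech_shell_minus[OF ab(1)] ab(2)] False by blast
  have "l = - k" using k(2) l(2) by (simp add: sum_negf)
  then have "k \<in> {-2, -1, 0, 1, 2}" using k(1) l(1) by auto
  moreover have "leech_vector a \<bullet> leech_vector b = real_of_int k"
    using k(2) by (simp add: inner_leech_vector)
  ultimately show ?thesis by auto
qed simp

lemma finite_leech_shell: "finite leech_shell"
proof (rule finite_subset)
  show "leech_shell \<subseteq> (\<Pi>\<^sub>E i\<in>UNIV. {-32..32})"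
  proof
    fix a assume a: "a \<in> leech_shell"
    have "a i \<in> {-32..32}" for i
    proof -
      have "(a i)\<^sup>2 = (\<Sum>j\<in>{i}. (a j)\<^sup>2)" by simp
      also have "\<dots> \<le> (\<Sum>j\<in>UNIV. (a j)\<^sup>2)" by (rule sum_mono2) auto
      also have "\<dots> \<le> 32\<^sup>2" using a by (simp add: leech_shell_def)
      finally have "\<bar>a i\<bar> \<le> \<bar>32\<bar>" by (simp only: abs_le_square_iff)
      then show ?thesis by auto
    qed
    then show "a \<in> (\<Pi>\<^sub>E i\<in>UNIV. {-32..32})" by auto
  qed
qed (auto intro: finite_PiE)

text \<open>The families are disjoint by their entries: only octad vectors contain 2 or -2, and only
  full vectors have odd entries.\<close>

lemma sum_shapes:
  "(\<Sum>b\<in>octad_vectors \<union> pair_vectors \<union> full_vectors. h b) =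
    (\<Sum>b\<in>octad_vectors. h b) + (\<Sum>b\<in>pair_vectors. h b) + (\<Sum>b\<in>full_vectors. h b)"
proof -
  have fin: "finite (octad_vectors \<union> pair_vectors \<union> full_vectors)"
    using shapes_in_leech_shell finite_leech_shell by (rule finite_subset)
  have octad: "(\<forall>i. b i \<in> {-2, 0, 2}) \<and> (\<exists>i. b i \<noteq> 0)" if octad: "b \<in> octad_vectors" for b
  proof -
    obtain B E where B: "card B = 8" "b = signed 2 B E"
      using octad by (auto simp: octad_vectors_def signed_design_def octads_def)
    then obtain i where "i \<in> B" by fastforce
    then show ?thesis using B by (auto simp: signed_def)
  qed
  have pair: "b i \<in> {-4, 0, 4}" if "b \<in> pair_vectors" for b i
    using that by (auto simp: pair_vectors_def signed_design_def signed_def split: if_splits)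
  have full: "b i \<in> {-3, -1, 1, 3}" if "b \<in> full_vectors" for b i
    using that by (auto simp: full_vectors_def full_vector_def split: if_splits)
  have "octad_vectors \<inter> pair_vectors = {}"
  proof -
    have False if b: "b \<in> octad_vectors" "b \<in> pair_vectors" for b
    proof -
      obtain i where "b i \<noteq> 0" "b i \<in> {-2, 0, 2}" using octad[OF b(1)] by blast
      then show False using pair[OF b(2), of i] by auto
    qed
    then show ?thesis by blast
  qed
  moreover have "(octad_vectors \<union> pair_vectors) \<inter> full_vectors = {}"
  proof -
    have False if "b \<in> octad_vectors \<union> pair_vectors" "b \<in> full_vectors" for b
    proof -
      have "b None \<in> {-2, 0, 2} \<or> b None \<in> {-4, 0, 4}" using octad pair that(1) by blast
      then show False using full[OF that(2), of None] by auto
    qed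
    then show ?thesis by blast
  qed
  ultimately show ?thesis
    using fin by (simp add: sum.union_disjoint)
qed

text \<open>
  The polynomial \<open>(t\<^sup>2 - 1) (t\<^sup>2 - 4)\<close> vanishes at the inner products \<open>\<plusminus>1, \<plusminus>2\<close>, is 4 at
  0 and 180 at \<open>\<plusminus>4\<close>, so its sum over the shell, which the moments determine, counts the orthogonal vectors.
\<close>

lemma card_orthogonal_ge:
  assumes a: "a \<in> leech_shell"
  shows "93150 \<le> card {b \<in> leech_shell. leech_vector a \<bullet> leech_vector b = 0}"
proof -
  let ?B = "octad_vectors \<union> pair_vectors \<union> full_vectors"
  let ?N = "{b \<in> leech_shell. leech_vector a \<bullet> leech_vector b = 0}"
  define x where "x i = real_of_int (a i)" for i
  define dot where "dot b = (\<Sum>i\<in>UNIV. x i * real_of_int (b i))" for b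
  have inner: "leech_vector a \<bullet> leech_vector b = dot b / 8" for b
    by (simp add: inner_leech_vector dot_def x_def)
  have x2: "(\<Sum>i\<in>UNIV. (x i)\<^sup>2) = 32"
  proof -
    have "(\<Sum>i\<in>UNIV. (x i)\<^sup>2) = real_of_int (\<Sum>i\<in>UNIV. (a i)\<^sup>2)" by (simp add: x_def)
    also have "(\<Sum>i\<in>UNIV. (a i)\<^sup>2) = 32" using a by (simp add: leech_shell_def)
    finally show ?thesis by simp
  qed
  define p where "p t = t ^ 4 - 5 * t\<^sup>2 + (4 :: real)" for t
  have fin: "finite ?B" using shapes_in_leech_shell finite_leech_shell by (rule finite_subset)
  have card: "(\<Sum>b\<in>?B. 1 :: real) = 196560"
    unfolding sum_shapes using octad_vectors_moments(1) pair_vectors_moments(1) full_vectors_moments(1) by simp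
  have two: "(\<Sum>b\<in>?B. (dot b)\<^sup>2) = 262080 * 32"
    unfolding sum_shapes dot_def octad_vectors_moments pair_vectors_moments full_vectors_moments x2 by simp
  have four: "(\<Sum>b\<in>?B. dot b ^ 4) = 967680 * 1024"
    unfolding sum_shapes dot_def octad_vectors_moments pair_vectors_moments full_vectors_moments x2 by simp
  \<comment> \<open>372960 = 4 * 93150 + 2 * 180, the last summand being the share of a and -a. The
    divisors 4096 and 64 arise because the inner product is \<open>dot b / 8\<close>.\<close>
  have "372960 = (\<Sum>b\<in>?B. dot b ^ 4) / 4096 - 5 / 64 * (\<Sum>b\<in>?B. (dot b)\<^sup>2) + 4 * (\<Sum>b\<in>?B. 1)"
    unfolding card two four by simp
  also have "\<dots> = (\<Sum>b\<in>?B. p (dot b / 8))"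
    unfolding sum_divide_distrib sum_distrib_left sum_subtractf[symmetric] sum.distrib[symmetric]
    by (rule sum.cong) (simp_all add: p_def power_divide)
  also have "\<dots> \<le> (\<Sum>b\<in>?B. 4 * (if b \<in> ?N then 1 else 0) + 180 * (if b \<in> {a, \<lambda>i. - a i} then 1 else 0))"
  proof (rule sum_mono)
    fix b assume "b \<in> ?B"
    then have b: "b \<in> leech_shell" using shapes_in_leech_shell by blast
    have self: "leech_vector a \<bullet> leech_vector a = 4"
      using norm_leech_vector[OF a] by (simp add: dot_square_norm)
    moreover have "leech_vector a \<bullet> leech_vector (\<lambda>i. - a i) = - (leech_vector a \<bullet> leech_vector a)"
      by (simp add: inner_leech_vector sum_negf)
    ultimately consider "b \<in> {a, \<lambda>i. - a i}" "dot b / 8 \<in> {4, -4}" | "dot b / 8 = 0"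
      | "dot b / 8 \<in> {-2, -1, 1, 2}"
      using leech_shell_inner[OF a b] unfolding inner by auto
    then show "p (dot b / 8) \<le> 4 * (if b \<in> ?N then 1 else 0) + 180 * (if b \<in> {a, \<lambda>i. - a i} then 1 else 0)"
    proof cases
      case 1
      then have "p (dot b / 8) = 180" by (auto simp: p_def)
      with 1(1) show ?thesis by simp
    next
      case 2
      then have "p (dot b / 8) = 4" unfolding 2 by (simp add: p_def)
      moreover have "b \<in> ?N" using b 2 unfolding inner by simp
      ultimately show ?thesis by simp
    next
      case 3
      then have "p (dot b / 8) = 0" by (auto simp: p_def)
      then show ?thesis by simp
    qed
  qed
  also have "\<dots> = 4 * real (card (?B \<inter> ?N)) + 180 * real (card (?B \<inter> {a, \<lambda>i. - a i}))"
    using fin by (simp only: sum.distrib sum_distrib_left[symmetric] sum.inter_restrict[symmetric]) simp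
  also have "card (?B \<inter> {a, \<lambda>i. - a i}) \<le> card {a, \<lambda>i. - a i}" by (rule card_mono) auto
  also have "\<dots> \<le> 2" by (simp add: card_insert_if)
  also have "card (?B \<inter> ?N) \<le> card ?N"
    using finite_leech_shell by (intro card_mono) auto
  finally show ?thesis by simp
qed

section \<open>The code in the hyperplane and its copy in dimension 23\<close>

lemma leech_sphere_eq: "leech_sphere = (\<lambda>b. leech_vector b /\<^sub>R 2) ` leech_shell"
  unfolding leech_sphere_def minimal_vectors_leech image_image
  by (rule image_cong) (simp_all add: norm_leech_vector)

lemma inner_products_leech_sphere:
  assumes "x \<in> leech_sphere" "y \<in> leech_sphere" "x \<noteq> y"
  shows "x \<bullet> y \<in> {-1, -1/2, -1/4, 0, 1/4, 1/2}"
proof -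
  obtain a b where ab: "a \<in> leech_shell" "x = leech_vector a /\<^sub>R 2" "b \<in> leech_shell" "y = leech_vector b /\<^sub>R 2"
    using assms(1,2) by (auto simp: leech_sphere_eq)
  have xy: "x \<bullet> y = leech_vector a \<bullet> leech_vector b / 4" by (simp add: ab)
  have "b \<noteq> a" using ab assms(3) by auto
  then consider "leech_vector a \<bullet> leech_vector b \<in> {-2, -1, 0, 1, 2}" | "b = (\<lambda>i. - a i)"
    using leech_shell_inner[OF ab(1,3)] by blast
  then show ?thesis
  proof cases
    case 1
    then show ?thesis unfolding xy by auto
  next
    case 2
    then have "leech_vector a \<bullet> leech_vector b = - (leech_vector a \<bullet> leech_vector a)"
      by (simp add: inner_leech_vector sum_negf)
    also have "leech_vector a \<bullet> leech_vector a = 4"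
      using norm_leech_vector[OF ab(1)] by (simp add: dot_square_norm)
    finally show ?thesis unfolding xy by simp
  qed
qed

lemma norm_leech_sphere: "x \<in> leech_sphere \<Longrightarrow> norm x = 1"
  by (auto simp: leech_sphere_eq norm_leech_vector)

lemma finite_leech_sphere: "finite leech_sphere"
  unfolding leech_sphere_eq using finite_leech_shell by simp

lemma card_C0_ge:
  assumes "x \<in> leech_sphere"
  shows "93150 \<le> card (C0 x)"
proof -
  obtain a where a: "a \<in> leech_shell" "x = leech_vector a /\<^sub>R 2"
    using assms by (auto simp: leech_sphere_eq)
  have "C0 x = (\<lambda>b. leech_vector b /\<^sub>R 2) ` {b \<in> leech_shell. leech_vector a \<bullet> leech_vector b = 0}"
    by (auto simp: C0_def leech_sphere_eq a)
  moreover have "inj (\<lambda>b. leech_vector b /\<^sub>R 2)"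
    by (rule injI) (simp add: leech_vector_eq_iff)
  ultimately have "card (C0 x) = card {b \<in> leech_shell. leech_vector a \<bullet> leech_vector b = 0}"
    by (simp add: card_image inj_on_subset)
  then show ?thesis using card_orthogonal_ge[OF a(1)] by simp
qed

lemma euclidean_iso_on_hyperplane:
  fixes x :: "real ^ coord"
  assumes "x \<noteq> 0"
  shows "\<exists>f :: real ^ coord \<Rightarrow> real ^ 23. euclidean_iso_on {v. x \<bullet> v = 0} f"
proof -
  let ?V = "{v. x \<bullet> v = 0}"
  have V: "subspace ?V" by (rule subspace_hyperplane)
  have "dim ?V = dim (UNIV :: (real ^ 23) set)"
    using dim_hyperplane[OF assms] by simp
  then obtain f :: "real ^ coord \<Rightarrow> real ^ 23" and g :: "real ^ 23 \<Rightarrow> real ^ coord"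
    where f: "linear f" "linear g" "f ` ?V = UNIV" "g ` UNIV = ?V"
      "\<And>v. v \<in> ?V \<Longrightarrow> norm (f v) = norm v" "\<And>v. v \<in> UNIV \<Longrightarrow> norm (g v) = norm v"
      "\<And>v. v \<in> ?V \<Longrightarrow> g (f v) = v" "\<And>v. v \<in> UNIV \<Longrightarrow> f (g v) = v"
    by (rule isometries_subspaces[OF V subspace_UNIV]) (rule that, assumption+)
  have "f u \<bullet> f v = u \<bullet> v" if "u \<in> ?V" "v \<in> ?V" for u v
  proof -
    have "u + v \<in> ?V" using V that by (rule subspace_add)
    \<comment> \<open>Polarisation: a linear map that preserves norms on the subspace preserves
      inner products there.\<close>
    then have "norm (f u + f v) = norm (u + v)" using f(5) by (simp add: linear_add[OF f(1), symmetric])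
    then show ?thesis using f(5)[OF that(1)] f(5)[OF that(2)] by (simp add: dot_norm)
  qed
  moreover have "bij_betw f ?V UNIV"
    using f(3) inj_on_inverseI[of ?V g f] f(7) by (simp add: bij_betw_def)
  ultimately show ?thesis unfolding euclidean_iso_on_def by blast
qed

text \<open>All three claims depend on inner products alone and so hold for every identification
  \<open>f\<close>. The count from the lattice and the linear programming bound meet at
  93150.\<close>

lemma C0_image_code:
  fixes f :: "real ^ coord \<Rightarrow> real ^ 23"
  assumes x: "x \<in> leech_sphere" and f: "euclidean_iso_on {v. x \<bullet> v = 0} f"
  shows "code_eq (1/2) (f ` C0 x)" "avoiding ({- (1/2)<..<- (1/4)} \<union> {0<..<1/4}) (f ` C0 x)"
    "card (f ` C0 x) = 93150"
proof -
  have inj: "inj_on f {v. x \<bullet> v = 0}" and inner: "\<And>u v. x \<bullet> u = 0 \<Longrightarrow> x \<bullet> v = 0 \<Longrightarrow> f u \<bullet> f v = u \<bullet> v"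
    using f by (auto simp: euclidean_iso_on_def bij_betw_def)
  have "inj_on f (C0 x)" using inj by (rule inj_on_subset) (auto simp: C0_def)
  then have ge: "93150 \<le> card (f ` C0 x)" using card_C0_ge[OF x] by (simp add: card_image)
  have ip: "inner_products (f ` C0 x) \<subseteq> {-1, -1/2, -1/4, 0, 1/4, 1/2}"
  proof
    fix t assume "t \<in> inner_products (f ` C0 x)"
    then obtain u v where "u \<in> C0 x" "v \<in> C0 x" "u \<noteq> v" "t = f u \<bullet> f v"
      by (auto simp: inner_products_def)
    then show "t \<in> {-1, -1/2, -1/4, 0, 1/4, 1/2}"
      using inner inner_products_leech_sphere[of u v] by (auto simp: C0_def)
  qed
  then have fin_ip: "finite (inner_products (f ` C0 x))" by (rule finite_subset) simp
  have fin: "finite (f ` C0 x)"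
    using finite_leech_sphere by (simp add: C0_def)
  have sphere: "f ` C0 x \<subseteq> sphere 0 1"
  proof
    fix y assume "y \<in> f ` C0 x"
    then obtain u where u: "u \<in> leech_sphere" "x \<bullet> u = 0" "y = f u" by (auto simp: C0_def)
    then show "y \<in> sphere 0 1" using inner[of u u] norm_leech_sphere[of u] by (simp add: norm_eq_1)
  qed
  have half: "1/2 \<in> inner_products (f ` C0 x)"
  proof (rule ccontr)
    assume "1/2 \<notin> inner_products (f ` C0 x)"
    with ip have "inner_products (f ` C0 x) \<subseteq> {-1, -1/2, -1/4, 0, 1/4}" by auto
    then have "card (f ` C0 x) \<le> 750" by (rule code_card_le_750[OF fin sphere])
    with ge show False by simp
  qed
  moreover have "Max (inner_products (f ` C0 x)) = 1/2"
  proof (rule Max_eqI[OF fin_ip _ half])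
    fix t assume "t \<in> inner_products (f ` C0 x)"
    with ip have "t \<in> {-1, -1/2, -1/4, 0, 1/4, 1/2}" by blast
    then show "t \<le> 1/2" by auto
  qed
  ultimately show eq: "code_eq (1/2) (f ` C0 x)"
    using fin sphere by (auto simp: code_eq_def spherical_code_def max_inner_product_def)
  show avoid: "avoiding ({- (1/2)<..<- (1/4)} \<union> {0<..<1/4}) (f ` C0 x)"
    unfolding avoiding_def using ip by fastforce
  have "code_le (1/2) (f ` C0 x)" using eq by (simp add: code_eq_def code_le_def)
  from code_card_le_93150[OF this avoid] ge show "card (f ` C0 x) = 93150" by simp
qed

theorem theorem5p2:
  fixes T :: "real set"
  assumes "T = {- (1/2)<..<- (1/4)} \<union> {0<..<1/4}"
  shows "max_code_size TYPE(23) (1/2) T = 93150 \<and>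
    (\<forall>x \<in> leech_sphere.
       (\<exists>f :: real ^ coord \<Rightarrow> real ^ 23. euclidean_iso_on {v. x \<bullet> v = 0} f) \<and>
       (\<forall>f :: real ^ coord \<Rightarrow> real ^ 23. euclidean_iso_on {v. x \<bullet> v = 0} f \<longrightarrow>
          maximal_code (1/2) T (f ` C0 x)))"
proof -
  have iso: "\<exists>f :: real ^ coord \<Rightarrow> real ^ 23. euclidean_iso_on {v. x \<bullet> v = 0} f"
    if "x \<in> leech_sphere" for x
    using norm_leech_sphere[OF that] by (intro euclidean_iso_on_hyperplane) auto
  have size: "max_code_size TYPE(23) (1/2) T = 93150"
    unfolding max_code_size_def
  proof (rule Max_eqI)
    let ?S = "{card C | C :: (real ^ 23) set. code_le (1/2) C \<and> avoiding T C}"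
    show le: "k \<le> 93150" if "k \<in> ?S" for k
      using that code_card_le_93150 unfolding assms by blast
    \<comment> \<open>The upper bound confines the cardinalities to a finite set, so that
      \<open>Max\<close> is a genuine maximum.\<close>
    show "finite ?S"
      by (rule finite_subset[of _ "{..93150}"]) (use le in auto)
    have "pair_vectors \<noteq> {}" using pair_vectors_moments(1) by auto
    then obtain x where x: "x \<in> leech_sphere"
      using shapes_in_leech_shell unfolding leech_sphere_eq by blast
    with iso obtain f :: "real ^ coord \<Rightarrow> real ^ 23" where "euclidean_iso_on {v. x \<bullet> v = 0} f"
      by blast
    note code = C0_image_code[OF x this, folded assms]
    then have "code_le (1/2) (f ` C0 x)" by (simp add: code_eq_def code_le_def)
    with code show "93150 \<in> ?S" by (intro CollectI exI[of _ "f ` C0 x"]) simp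
  qed
  with iso show ?thesis
    using C0_image_code unfolding assms maximal_code_def by simp
qed

end
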